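(* Let $a\in\mathbb{N}$, $q_0=2^a$, $q=2q_0^2$, and let $\mathcal{S}_q$ be the Suzuki curve (the smooth projective curve with affine model $y^q+y=x^{q_0}(x^q+x)$). Then there are linear locally recoverable codes with availability $2$ and locality $(q-1,q-2)$, obtained by evaluating a space of rational functions on $\mathcal{S}_q$ at a set of rational points of $\mathcal{S}_q$: (1) over $\mathbb{F}_q$, with length $n=q(q-1)$ and dimension $k=(q-1)(q-2)$; and (2) over $\mathbb{F}_{q^4}$, with length $n=q(q-1)(q^2+2qq_0+q+1)$ and dimension $k=(q-1)(q-2)(q^2+2qq_0+q+1)$.
   Context: A linear code of length $n$ has availability $2$ and locality $(r_1,r_2)$ if each position $i$ has two disjoint sets $A_{i1},A_{i2}\subseteq[n]\setminus\{i\}$ with $|A_{ij}|=r_j$ such that the $i$-th entry of every codeword is a function of its entries on $A_{ij}$, for $j=1,2$. *)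

theory Defs
  imports
    "HOL-Algebra.Subrings"
    "HOL-Computational_Algebra.Factorial_Ring"
    "HOL-Computational_Algebra.Polynomial"
    "HOL-Library.Cardinality"
    "HOL-Library.Function_Algebras"
    "HOL-Library.FuncSet"
begin

section \<open>Function field of an affine plane curve\<close>

text \<open>
  The type \<^typ>\<open>'k poly poly\<close> stands for \<open>K[X,Y]\<close>, with \<open>Y\<close> the outer variable.
  The function field of the irreducible curve \<open>f = 0\<close> is the field of fractions of
  \<open>K[X,Y]/(f)\<close>. Its elements are the classes of fractions \<open>g/h\<close> with \<open>f\<close> not dividing \<open>h\<close>,
  where \<open>g/h\<close> and \<open>g'/h'\<close> are identified iff \<open>f\<close> divides \<open>g h' - g' h\<close>.
\<close>

definition fraction_rel ::
  "'k::field poly poly \<Rightarrow> (('k poly poly \<times> 'k poly poly) \<times> ('k poly poly \<times> 'k poly poly)) set" where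
  "fraction_rel f =
    {((g, h), (g', h')). \<not> f dvd h \<and> \<not> f dvd h' \<and> f dvd g * h' - g' * h}"

definition fraction ::
  "'k::field poly poly \<Rightarrow> 'k poly poly \<Rightarrow> 'k poly poly \<Rightarrow> ('k poly poly \<times> 'k poly poly) set" where
  "fraction f g h = fraction_rel f `` {(g, h)}"

definition function_field ::
  "'k::field poly poly \<Rightarrow> ('k poly poly \<times> 'k poly poly) set ring" where
  "function_field f =
    \<lparr>carrier = {fraction f g h | g h. \<not> f dvd h},
     monoid.mult = (\<lambda>A B. \<Union>(g, h)\<in>A. \<Union>(g', h')\<in>B. fraction f (g * g') (h * h')),
     one = fraction f 1 1,
     zero = fraction f 0 1,
     add = (\<lambda>A B. \<Union>(g, h)\<in>A. \<Union>(g', h')\<in>B. fraction f (g * h' + g' * h) (h * h'))\<rparr>"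

definition const_fun ::
  "'k::field poly poly \<Rightarrow> 'k \<Rightarrow> ('k poly poly \<times> 'k poly poly) set" where
  "const_fun f c = fraction f [:[:c:]:] 1"

lemma equiv_fraction_rel:
  assumes "prime_elem f"
  shows "equiv {(g, h). \<not> f dvd h} (fraction_rel f)"
proof (rule equivI)
  show "fraction_rel f \<subseteq> {(g, h). \<not> f dvd h} \<times> {(g, h). \<not> f dvd h}"
    by (auto simp: fraction_rel_def)
  show "refl_on {(g, h). \<not> f dvd h} (fraction_rel f)"
    by (auto simp: refl_on_def fraction_rel_def)
  show "sym (fraction_rel f)"
    by (auto simp: sym_def fraction_rel_def) (metis dvd_minus_iff minus_diff_eq)+
  show "trans (fraction_rel f)"
  proof (rule transI, clarsimp simp: fraction_rel_def)
    fix g h g' h' g'' h''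
    assume h': "\<not> f dvd h'" and 1: "f dvd g * h' - g' * h" and 2: "f dvd g' * h'' - g'' * h'"
    have "f dvd (g * h' - g' * h) * h'' + (g' * h'' - g'' * h') * h"
      using 1 2 by (intro dvd_add dvd_mult2)
    also have "\<dots> = h' * (g * h'' - g'' * h)" by (simp add: algebra_simps)
    finally show "f dvd g * h'' - g'' * h"
      using h' assms by (simp add: prime_elem_dvd_mult_iff)
  qed
qed

lemma fraction_eq_iff:
  assumes "prime_elem f" "\<not> f dvd h" "\<not> f dvd h'"
  shows "fraction f g h = fraction f g' h' \<longleftrightarrow> f dvd g * h' - g' * h"
  using eq_equiv_class_iff[OF equiv_fraction_rel[OF assms(1)], of "(g,h)" "(g',h')"] assms
  by (auto simp: fraction_def fraction_rel_def)

lemma in_fraction: "(g', h') \<in> fraction f g h \<longleftrightarrow> \<not> f dvd h \<and> \<not> f dvd h' \<and> f dvd g * h' - g' * h"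
  by (auto simp: fraction_def fraction_rel_def)

lemma function_field_mult:
  assumes f: "prime_elem f" and h: "\<not> f dvd h" "\<not> f dvd k"
  shows "fraction f g h \<otimes>\<^bsub>function_field f\<^esub> fraction f e k = fraction f (g * e) (h * k)"
proof -
  have *: "fraction f (g' * e') (h' * k') = fraction f (g * e) (h * k)"
    if "(g',h') \<in> fraction f g h" "(e',k') \<in> fraction f e k" for g' h' e' k'
  proof -
    from that have d: "\<not> f dvd h'" "\<not> f dvd k'" "f dvd g * h' - g' * h" "f dvd e * k' - e' * k"
      by (auto simp: in_fraction)
    have "f dvd (g * h' - g' * h) * (e * k') + (e * k' - e' * k) * (g' * h)"
      using d by (intro dvd_add dvd_mult2)
    also have "\<dots> = (g * e) * (h' * k') - (g' * e') * (h * k)" by (simp add: algebra_simps)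
    finally show ?thesis using d h f
      by (subst eq_commute, subst fraction_eq_iff) (auto simp: prime_elem_dvd_mult_iff)
  qed
  have "(g,h) \<in> fraction f g h" "(e,k) \<in> fraction f e k" using h by (auto simp: in_fraction)
  note mem = this
  have "(\<Union>y\<in>fraction f e k. case y of (e', k') \<Rightarrow> fraction f (g' * e') (h' * k')) = fraction f (g * e) (h * k)"
    if "(g', h') \<in> fraction f g h" for g' h'
    using mem(2) by (rule UN_constant_eq) (auto simp only: split_paired_all prod.case *[OF that])
  then have "(\<Union>x\<in>fraction f g h. case x of (g', h') \<Rightarrow>
      \<Union>y\<in>fraction f e k. case y of (e', k') \<Rightarrow> fraction f (g' * e') (h' * k')) = fraction f (g * e) (h * k)"
    by (intro UN_constant_eq[OF mem(1)]) (auto simp only: split_paired_all prod.case)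
  then show ?thesis by (simp add: function_field_def)
qed

lemma function_field_add:
  assumes f: "prime_elem f" and h: "\<not> f dvd h" "\<not> f dvd k"
  shows "fraction f g h \<oplus>\<^bsub>function_field f\<^esub> fraction f e k = fraction f (g * k + e * h) (h * k)"
proof -
  have *: "fraction f (g' * k' + e' * h') (h' * k') = fraction f (g * k + e * h) (h * k)"
    if "(g',h') \<in> fraction f g h" "(e',k') \<in> fraction f e k" for g' h' e' k'
  proof -
    from that have d: "\<not> f dvd h'" "\<not> f dvd k'" "f dvd g * h' - g' * h" "f dvd e * k' - e' * k"
      by (auto simp: in_fraction)
    have "f dvd (g * h' - g' * h) * (k * k') + (e * k' - e' * k) * (h * h')"
      using d by (intro dvd_add dvd_mult2)
    also have "\<dots> = (g * k + e * h) * (h' * k') - (g' * k' + e' * h') * (h * k)" by (simp add: algebra_simps)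
    finally show ?thesis using d h f
      by (subst eq_commute, subst fraction_eq_iff) (auto simp: prime_elem_dvd_mult_iff)
  qed
  have "(g,h) \<in> fraction f g h" "(e,k) \<in> fraction f e k" using h by (auto simp: in_fraction)
  note mem = this
  have "(\<Union>y\<in>fraction f e k. case y of (e', k') \<Rightarrow> fraction f (g' * k' + e' * h') (h' * k')) = fraction f (g * k + e * h) (h * k)"
    if "(g', h') \<in> fraction f g h" for g' h'
    using mem(2) by (rule UN_constant_eq) (auto simp only: split_paired_all prod.case *[OF that])
  then have "(\<Union>x\<in>fraction f g h. case x of (g', h') \<Rightarrow>
      \<Union>y\<in>fraction f e k. case y of (e', k') \<Rightarrow> fraction f (g' * k' + e' * h') (h' * k')) = fraction f (g * k + e * h) (h * k)"
    by (intro UN_constant_eq[OF mem(1)]) (auto simp only: split_paired_all prod.case)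
  then show ?thesis by (simp add: function_field_def)
qed

lemma field_function_field:
  assumes f: "prime_elem f"
  shows "field (function_field f)"
proof -
  let ?F = "function_field f"
  have n1: "\<not> f dvd 1" using f by (auto simp: prime_elem_def)
  have car: "carrier ?F = {fraction f g h | g h. \<not> f dvd h}" and
    one: "\<one>\<^bsub>?F\<^esub> = fraction f 1 1" and zero: "\<zero>\<^bsub>?F\<^esub> = fraction f 0 1"
    by (simp_all add: function_field_def)
  note S = one zero function_field_mult[OF f] function_field_add[OF f] fraction_eq_iff[OF f]
    prime_elem_dvd_mult_iff[OF f] n1
  have I: "fraction f g h \<in> carrier ?F" if "\<not> f dvd h" for g h using that by (auto simp: car)
  have E: "\<exists>g h. x = fraction f g h \<and> \<not> f dvd h" if "x \<in> carrier ?F" for x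
    using that by (auto simp: car)
  have neg: "\<exists>y\<in>carrier ?F. y \<oplus>\<^bsub>?F\<^esub> x = \<zero>\<^bsub>?F\<^esub>" if xc: "x \<in> carrier ?F" for x
  proof -
    obtain g h where x: "x = fraction f g h" "\<not> f dvd h" using E[OF xc] by auto
    show ?thesis by (rule bexI[of _ "fraction f (-g) h"]) (use x in \<open>auto simp: S I\<close>)
  qed
  have ab: "abelian_group ?F"
  proof (rule abelian_groupI)
    show "\<exists>y\<in>carrier ?F. y \<oplus>\<^bsub>?F\<^esub> x = \<zero>\<^bsub>?F\<^esub>" if "x \<in> carrier ?F" for x
      by (rule neg[OF that])
  qed (auto dest!: E simp: S I algebra_simps)
  have cm: "comm_monoid ?F"
    by (rule comm_monoidI) (auto dest!: E simp: S I algebra_simps)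
  have cr: "cring ?F"
    by (rule cringI[OF ab cm]) (clarsimp dest!: E simp: S I algebra_simps)
  show ?thesis
  proof (rule cring.cring_fieldI2[OF cr])
    show "\<zero>\<^bsub>?F\<^esub> \<noteq> \<one>\<^bsub>?F\<^esub>" by (simp add: S)
    fix x assume xc: "x \<in> carrier ?F" "x \<noteq> \<zero>\<^bsub>?F\<^esub>"
    obtain g h where x: "x = fraction f g h" "\<not> f dvd h" using E[OF xc(1)] by auto
    with xc(2) have "\<not> f dvd g" by (simp add: S)
    note x = x this
    show "\<exists>y\<in>carrier ?F. x \<otimes>\<^bsub>?F\<^esub> y = \<one>\<^bsub>?F\<^esub>"
      by (rule bexI[of _ "fraction f h g"]) (use x in \<open>auto simp: S I\<close>)
  qed
qed


section \<open>Rational points of the smooth projective model\<close>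

text \<open>
  The closed points of the smooth projective curve with function field \<open>F/K\<close> are the places of
  \<open>F/K\<close>, each given by its valuation ring; the \<open>K\<close>-rational points are those with residue field
  \<open>K\<close>. The map \<open>\<kappa>\<close> is the embedding of the field of constants \<open>K\<close> into \<open>F\<close>.
\<close>

definition valuation_ring :: "'f ring \<Rightarrow> ('k \<Rightarrow> 'f) \<Rightarrow> 'f set \<Rightarrow> bool" where
  "valuation_ring F \<kappa> V \<longleftrightarrow>
     subring V F \<and> range \<kappa> \<subset> V \<and> V \<subset> carrier F \<and>
     (\<forall>z \<in> carrier F - {\<zero>\<^bsub>F\<^esub>}. z \<in> V \<or> inv\<^bsub>F\<^esub> z \<in> V)"

definition maximal_ideal_of :: "'f ring \<Rightarrow> 'f set \<Rightarrow> 'f set" where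
  "maximal_ideal_of F V = {z \<in> V. z = \<zero>\<^bsub>F\<^esub> \<or> inv\<^bsub>F\<^esub> z \<notin> V}"

definition rational_point :: "'f ring \<Rightarrow> ('k \<Rightarrow> 'f) \<Rightarrow> 'f set \<Rightarrow> bool" where
  "rational_point F \<kappa> V \<longleftrightarrow>
     valuation_ring F \<kappa> V \<and> (\<forall>z \<in> V. \<exists>c. z \<ominus>\<^bsub>F\<^esub> \<kappa> c \<in> maximal_ideal_of F V)"

text \<open>The value of a function regular at a rational point, i.e. lying in its valuation ring.\<close>

definition value_at :: "'f ring \<Rightarrow> ('k \<Rightarrow> 'f) \<Rightarrow> 'f set \<Rightarrow> 'f \<Rightarrow> 'k" where
  "value_at F \<kappa> V z = (THE c. z \<ominus>\<^bsub>F\<^esub> \<kappa> c \<in> maximal_ideal_of F V)"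

definition function_space :: "'f ring \<Rightarrow> ('k \<Rightarrow> 'f) \<Rightarrow> 'f set \<Rightarrow> bool" where
  "function_space F \<kappa> L \<longleftrightarrow>
     subgroup L (add_monoid F) \<and> (\<forall>c. \<forall>z \<in> L. \<kappa> c \<otimes>\<^bsub>F\<^esub> z \<in> L)"


section \<open>Linear codes\<close>

text \<open>
  A word of length \<open>n\<close> over \<open>K\<close> is a function on \<^typ>\<open>nat\<close> that vanishes outside \<open>{..<n}\<close>.
\<close>

definition scale_word :: "'k::field \<Rightarrow> (nat \<Rightarrow> 'k) \<Rightarrow> nat \<Rightarrow> 'k" where
  "scale_word c w = (\<lambda>i. c * w i)"

global_interpretation word: vector_space scale_word
  by unfold_locales (auto simp: scale_word_def fun_eq_iff algebra_simps)

definition linear_code :: "nat \<Rightarrow> (nat \<Rightarrow> 'k::field) set \<Rightarrow> bool" where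
  "linear_code n C \<longleftrightarrow> word.subspace C \<and> (\<forall>w \<in> C. \<forall>i \<ge> n. w i = 0)"

definition recovery_set :: "(nat \<Rightarrow> 'k) set \<Rightarrow> nat \<Rightarrow> nat set \<Rightarrow> bool" where
  "recovery_set C i A \<longleftrightarrow> (\<exists>\<phi>. \<forall>w \<in> C. w i = \<phi> (restrict w A))"

definition availability2_locality :: "nat \<Rightarrow> (nat \<Rightarrow> 'k) set \<Rightarrow> nat \<Rightarrow> nat \<Rightarrow> bool" where
  "availability2_locality n C r\<^sub>1 r\<^sub>2 \<longleftrightarrow>
     (\<forall>i < n. \<exists>A\<^sub>1 A\<^sub>2.
        A\<^sub>1 \<subseteq> {..<n} - {i} \<and> A\<^sub>2 \<subseteq> {..<n} - {i} \<and> A\<^sub>1 \<inter> A\<^sub>2 = {} \<and>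
        card A\<^sub>1 = r\<^sub>1 \<and> card A\<^sub>2 = r\<^sub>2 \<and>
        recovery_set C i A\<^sub>1 \<and> recovery_set C i A\<^sub>2)"

definition evaluation_code ::
  "'f ring \<Rightarrow> ('k::field \<Rightarrow> 'f) \<Rightarrow> nat \<Rightarrow> (nat \<Rightarrow> 'f set) \<Rightarrow> 'f set \<Rightarrow> (nat \<Rightarrow> 'k) set" where
  "evaluation_code F \<kappa> n P L =
     (\<lambda>z i. if i < n then value_at F \<kappa> (P i) z else 0) ` L"

definition is_evaluation_code :: "'f ring \<Rightarrow> ('k::field \<Rightarrow> 'f) \<Rightarrow> nat \<Rightarrow> (nat \<Rightarrow> 'k) set \<Rightarrow> bool" where
  "is_evaluation_code F \<kappa> n C \<longleftrightarrow>
     (\<exists>P L. inj_on P {..<n} \<and> (\<forall>i < n. rational_point F \<kappa> (P i)) \<and>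
        function_space F \<kappa> L \<and> (\<forall>i < n. L \<subseteq> P i) \<and>
        C = evaluation_code F \<kappa> n P L)"


section \<open>The Suzuki curve\<close>

definition suzuki_poly :: "nat \<Rightarrow> nat \<Rightarrow> 'k::field poly poly" where
  "suzuki_poly q0 q =
     monom 1 q + monom 1 1 - [:monom 1 q0 * (monom 1 q + monom 1 1):]"

definition suzuki_evaluation_code :: "nat \<Rightarrow> nat \<Rightarrow> nat \<Rightarrow> (nat \<Rightarrow> 'k::field) set \<Rightarrow> bool" where
  "suzuki_evaluation_code q0 q n C \<longleftrightarrow>
     is_evaluation_code (function_field (suzuki_poly q0 q)) (const_fun (suzuki_poly q0 q)) n C"

end

theory Submission
  imports
    Defs
    "Berlekamp_Zassenhaus.Finite_Field"
    "HOL-Combinatorics.Orbits"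
    "HOL-Computational_Algebra.Polynomial_FPS"
    "HOL-Number_Theory.Gauss"
begin

text \<open>
  Let \<open>F x = x^q0 (x^q + x)\<close>. The group of maps \<open>(x, y) \<mapsto> (z x, z^(q0+1) y + b)\<close> with
  \<open>z\<close>, \<open>b\<close> in \<open>F_q\<close> and \<open>z \<noteq> 0\<close> acts freely on the affine points with \<open>x \<noteq> 0\<close>. The code consists
  of the values at all of these points of the polynomials spanned by the monomials \<open>x^i y^j\<close> with
  \<open>j \<le> q - 2\<close>, \<open>i\<close> smaller than the number of abscissas, and \<open>i + (q0 + 1) j\<close> not divisible by
  \<open>q - 1\<close>. One recovers along a fibre of \<open>x\<close> by interpolation in \<open>y\<close>, and along an orbit of the
  torus because the values on it sum to zero.

  The points are counted with the quadratic form \<open>Tr (F x)\<close> on \<open>F_(q^4)\<close> over \<open>F_2\<close>. Its radical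
  has \<open>2 q\<close> elements and the form vanishes there, so the exponential sum is \<open>\<plusminus> 2 q0 q^2\<close>. The sign
  is found by descending to the subfields of degree \<open>4 d\<close> with \<open>d\<close> dividing \<open>log_2 q\<close>: a Galois
  orbit argument gives a congruence modulo each prime \<open>p\<close> between the sums for \<open>d p\<close> and \<open>d\<close>, and
  \<open>2^((p-1)/2)\<close> modulo \<open>p\<close> is known; the descent ends in \<open>F_16\<close>.

  For the places, a point \<open>(x0, y0)\<close> gives a homomorphism from \<open>K[X, Y]\<close> to \<open>K[[t]]\<close> with
  \<open>X \<mapsto> x0 + t\<close>, and \<open>Y\<close> mapped to the power series solution through \<open>y0\<close>. Its kernel is generated
  by the equation of the curve, which proves irreducibility, and the pullback of \<open>K[[t]]\<close> is the
  valuation ring. If the kernel were larger, the Artin-Schreier extension would contain a trace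
  \<open>Tr (c Y)\<close> that is a polynomial in \<open>X\<close>; comparing the coefficients at \<open>2^i (2 q0 + 1)\<close> shows that
  this is impossible.
\<close>

unbundle fps_syntax

hide_const (open) up_ring.coeff up_ring.monom

section \<open>Maps of prime order\<close>

lemma funpow_gcd:
  assumes "(f ^^ m) x = x" "(f ^^ n) x = x"
  shows "(f ^^ gcd m n) x = x"
  using assms
proof (induction m n rule: gcd_nat_induct)
  case (step m n)
  then have "(f ^^ (m mod n)) x = x" by (simp add: funpow_mod_eq)
  with step show ?case by (simp add: gcd_red_nat[of m n])
qed simp

lemma card_orbit_prime_period:
  assumes prime_p: "prime p" and period: "(f ^^ p) x = x" and moved: "f x \<noteq> x"
  shows "card (orbit f x) = p"
proof -
  have "inj_on (\<lambda>k. (f ^^ k) x) {..<p}"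
  proof (rule linorder_inj_onI')
    fix i j assume "i \<in> {..<p}" "j \<in> {..<p}" and less: "i < j"
    then have "j < p" by simp
    show "(f ^^ i) x \<noteq> (f ^^ j) x"
    proof
      assume "(f ^^ i) x = (f ^^ j) x"
      then have "(f ^^ (p - i + i)) x = (f ^^ (p - i + j)) x" by (simp only: funpow_add comp_apply)
      moreover have "p - i + i = p" "p - i + j = (j - i) + p" using less \<open>j < p\<close> by auto
      moreover have "(f ^^ ((j - i) + p)) x = (f ^^ (j - i)) x"
        by (simp only: funpow_add comp_apply period)
      ultimately have "(f ^^ (j - i)) x = x" using period by metis
      then have "(f ^^ gcd p (j - i)) x = x" by (rule funpow_gcd[OF period])
      moreover have "coprime p (j - i)"
        using prime_p less \<open>j < p\<close> by (intro prime_imp_coprime) (auto dest: dvd_imp_le)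
      ultimately show False using moved by simp
    qed
  qed
  moreover have "orbit f x = (\<lambda>k. (f ^^ k) x) ` {..<p}"
    using orbit_altdef_bounded[OF period prime_gt_0_nat[OF prime_p]] by auto
  ultimately show ?thesis by (simp add: card_image)
qed

lemma orbit_eq_orbit:
  assumes "x \<in> orbit f x" "y \<in> orbit f x"
  shows "orbit f y = orbit f x"
  using orbit_cyclic_eq3[of f "orbit f x" y] assms by (auto simp: cyclic_on_def)

lemma prime_dvd_sum_of_moved:
  fixes v :: "'a \<Rightarrow> int"
  assumes "finite A" and prime_p: "prime p" and closed: "\<And>x. x \<in> A \<Longrightarrow> f x \<in> A"
    and period: "\<And>x. x \<in> A \<Longrightarrow> (f ^^ p) x = x" and moved: "\<And>x. x \<in> A \<Longrightarrow> f x \<noteq> x"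
    and invariant: "\<And>x. x \<in> A \<Longrightarrow> v (f x) = v x"
  shows "int p dvd (\<Sum>x\<in>A. v x)"
proof -
  have self: "x \<in> orbit f x" if "x \<in> A" for x
    using period[OF that] prime_gt_0_nat[OF prime_p]
    by (auto simp: orbit_altdef intro!: exI[of _ p])
  have orbit_A: "y \<in> A \<and> v y = v x" if "y \<in> orbit f x" "x \<in> A" for x y
    using that by induction (simp_all add: closed invariant)
  have "\<Union> (orbit f ` A) = A" using orbit_A self by auto
  moreover have "orbit f x \<inter> orbit f y = {}"
    if "x \<in> A" "y \<in> A" "orbit f x \<noteq> orbit f y" for x y
    using that orbit_eq_orbit[OF self] by blast
  moreover have "finite (orbit f x)" if "x \<in> A" for x by (rule finite_orbit[OF self[OF that]])
  ultimately have "(\<Sum>x\<in>A. v x) = (\<Sum>orb\<in>orbit f ` A. \<Sum>x\<in>orb. v x)"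
    using sum.Union_disjoint[of "orbit f ` A" v] by (simp add: comp_def)
  moreover have "int p dvd (\<Sum>y\<in>orbit f x. v y)" if "x \<in> A" for x
  proof -
    have "(\<Sum>y\<in>orbit f x. v y) = (\<Sum>y\<in>orbit f x. v x)"
      by (intro sum.cong refl) (simp add: orbit_A that)
    also have "\<dots> = int p * v x"
      by (simp add: card_orbit_prime_period[OF prime_p period moved] that)
    finally show ?thesis by simp
  qed
  ultimately show ?thesis by (auto intro: dvd_sum)
qed

lemma sum_cong_sum_fixed_points:
  fixes v :: "'a \<Rightarrow> int"
  assumes "finite A" "prime p" and closed: "\<And>x. x \<in> A \<Longrightarrow> f x \<in> A"
    and period: "\<And>x. x \<in> A \<Longrightarrow> (f ^^ p) x = x" and invariant: "\<And>x. x \<in> A \<Longrightarrow> v (f x) = v x"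
  shows "[(\<Sum>x\<in>A. v x) = (\<Sum>x | x \<in> A \<and> f x = x. v x)] (mod int p)"
proof -
  define moved where "moved = {x \<in> A. f x \<noteq> x}"
  have "f (f x) \<noteq> f x" if "x \<in> moved" for x
  proof
    assume "f (f x) = f x"
    moreover have "x \<in> orbit f x"
      using that period[of x] prime_gt_0_nat[OF \<open>prime p\<close>]
      by (auto simp: moved_def orbit_altdef intro!: exI[of _ p])
    ultimately show False
      using that self_in_orbit_step[of x f] orbit_eq_singleton_iff[of f "f x"]
      by (auto simp: moved_def)
  qed
  then have "int p dvd (\<Sum>x\<in>moved. v x)"
    using assms by (intro prime_dvd_sum_of_moved[of moved p f]) (auto simp: moved_def)
  moreover have "A - moved = {x \<in> A. f x = x}" by (auto simp: moved_def)
  then have "(\<Sum>x\<in>A. v x) = (\<Sum>x | x \<in> A \<and> f x = x. v x) + (\<Sum>x\<in>moved. v x)"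
    using sum.subset_diff[of moved A v] \<open>finite A\<close> by (simp add: moved_def subset_iff)
  ultimately show ?thesis by (simp add: cong_iff_dvd_diff)
qed

section \<open>Rings of characteristic two\<close>

lemma add_self_CHAR_2: "CHAR('a) = 2 \<Longrightarrow> x + x = 0" for x :: "'a::ring_1"
  using uminus_CHAR_2[of x] by (metis add.right_inverse)

lemma add_add_cancel_CHAR_2: "CHAR('a) = 2 \<Longrightarrow> x + (x + y) = y" for x y :: "'a::ring_1"
  by (simp add: add.assoc[symmetric] add_self_CHAR_2)

lemma add_eq_0_iff_CHAR_2: "CHAR('a) = 2 \<Longrightarrow> x + y = 0 \<longleftrightarrow> x = y" for x y :: "'a::ring_1"
  by (metis minus_CHAR_2 right_minus_eq)

lemma square_add_eq_0_iff_CHAR_2: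
  fixes x :: "'a::idom"
  assumes "CHAR('a) = 2"
  shows "x\<^sup>2 + x = 0 \<longleftrightarrow> x = 0 \<or> x = 1"
proof -
  have "x\<^sup>2 + x = x * (x + 1)" by (simp add: power2_eq_square distrib_left)
  then show ?thesis by (simp add: add_eq_0_iff_CHAR_2[OF assms])
qed

lemma frobenius_add:
  fixes x y :: "'a::comm_ring_1"
  assumes "CHAR('a) = 2"
  shows "(x + y) ^ (2 ^ k) = x ^ (2 ^ k) + y ^ (2 ^ k)"
  by (rule freshmans_dream'[of _ k]) (simp_all add: assms)

lemma power2_add_CHAR_2: "CHAR('a) = 2 \<Longrightarrow> (x + y)\<^sup>2 = x\<^sup>2 + y\<^sup>2" for x y :: "'a::comm_ring_1"
  using frobenius_add[of x y 1] by simp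

lemma frobenius_sum:
  fixes g :: "'b \<Rightarrow> 'a::comm_ring_1"
  assumes "CHAR('a) = 2"
  shows "(\<Sum>i\<in>A. g i) ^ (2 ^ k) = (\<Sum>i\<in>A. g i ^ (2 ^ k))"
  by (rule freshmans_dream_sum'[of _ k]) (simp_all add: assms)

lemma frobenius_comp: "(x ^ (2 ^ i)) ^ (2 ^ j) = x ^ (2 ^ (i + j))" for x :: "'a::monoid_mult"
  by (simp add: power_mult[symmetric] power_add)

lemma funpow_frobenius: "((\<lambda>x. x ^ (2 ^ d)) ^^ k) x = x ^ (2 ^ (d * k))" for x :: "'a::monoid_mult"
  by (induction k) (simp_all add: frobenius_comp add.commute)

definition frob_fixed :: "nat \<Rightarrow> 'a::comm_ring_1 set" where
  "frob_fixed d = {x. x ^ (2 ^ d) = x}"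

lemma frob_fixedD: "x \<in> frob_fixed d \<Longrightarrow> x ^ (2 ^ d) = x"
  by (simp add: frob_fixed_def)

lemma frob_fixed_iff_funpow: "x \<in> frob_fixed d \<longleftrightarrow> ((\<lambda>x. x\<^sup>2) ^^ d) x = x"
  using funpow_frobenius[of d 1 x] by (simp add: frob_fixed_def)

lemma frob_fixed_mod:
  assumes "x \<in> frob_fixed d"
  shows "x ^ (2 ^ (e mod d)) = x ^ (2 ^ e)"
  using funpow_mod_eq[of d "\<lambda>x. x\<^sup>2" x e] assms funpow_frobenius[of _ 1 x]
  by (simp add: frob_fixed_iff_funpow)

lemma frob_fixed_mono: "d dvd e \<Longrightarrow> frob_fixed d \<subseteq> frob_fixed e"
proof
  fix x :: 'a assume "d dvd e" "x \<in> frob_fixed d"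
  then show "x \<in> frob_fixed e" using frob_fixed_mod[of x d e] by (simp add: frob_fixed_def[of e])
qed

lemma frob_fixed_Int: "frob_fixed d \<inter> frob_fixed e = frob_fixed (gcd d e)"
proof
  show "frob_fixed d \<inter> frob_fixed e \<subseteq> frob_fixed (gcd d e)"
    by (simp add: frob_fixed_iff_funpow funpow_gcd subset_iff)
qed (simp add: frob_fixed_mono)

lemma frob_fixed_0: "0 \<in> frob_fixed d"
  and frob_fixed_1: "1 \<in> frob_fixed d"
  by (simp_all add: frob_fixed_def power_0_left)

lemma frob_fixed_mult: "x \<in> frob_fixed d \<Longrightarrow> y \<in> frob_fixed d \<Longrightarrow> x * y \<in> frob_fixed d"
  by (simp add: frob_fixed_def power_mult_distrib)

lemma frob_fixed_power: "x \<in> frob_fixed d \<Longrightarrow> x ^ k \<in> frob_fixed d"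
  by (induction k) (simp_all add: frob_fixed_1 frob_fixed_mult)

lemma frob_fixed_divide: "x \<in> frob_fixed d \<Longrightarrow> y \<in> frob_fixed d \<Longrightarrow> x / y \<in> frob_fixed d"
  for x y :: "'a::field"
  by (simp add: frob_fixed_def power_divide)

lemma frob_fixed_add:
  fixes x y :: "'a::comm_ring_1"
  assumes "CHAR('a) = 2" "x \<in> frob_fixed d" "y \<in> frob_fixed d"
  shows "x + y \<in> frob_fixed d"
  using assms by (simp add: frob_fixed_def frobenius_add)

lemmas frob_fixed_closed = frob_fixed_0 frob_fixed_1 frob_fixed_mult frob_fixed_power

definition abs_trace :: "nat \<Rightarrow> 'a::comm_ring_1 \<Rightarrow> 'a" where
  "abs_trace d x = (\<Sum>i<d. x ^ (2 ^ i))"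

lemma abs_trace_0 [simp]: "abs_trace d 0 = 0"
  by (simp add: abs_trace_def power_0_left)

lemma abs_trace_add:
  fixes x y :: "'a::comm_ring_1"
  assumes "CHAR('a) = 2"
  shows "abs_trace d (x + y) = abs_trace d x + abs_trace d y"
  by (simp add: abs_trace_def frobenius_add[OF assms] sum.distrib)

lemma abs_trace_add_degree: "abs_trace (d + e) x = abs_trace d x + abs_trace e (x ^ (2 ^ d))"
  by (induction e) (simp_all add: abs_trace_def frobenius_comp add.assoc)

lemma abs_trace_mult_degree:
  assumes "x \<in> frob_fixed d"
  shows "abs_trace (d * k) x = of_nat k * abs_trace d x"
  by (induction k)
    (simp_all add: abs_trace_add_degree frob_fixedD[OF assms] abs_trace_def[of 0] algebra_simps)

lemma abs_trace_square_add:
  fixes x :: "'a::comm_ring_1"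
  assumes "CHAR('a) = 2"
  shows "(abs_trace d x)\<^sup>2 + abs_trace d x = x ^ (2 ^ d) + x"
proof -
  have "(abs_trace d x)\<^sup>2 = (\<Sum>i<d. x ^ (2 ^ Suc i))"
    using frobenius_sum[OF assms, of "\<lambda>i. x ^ (2 ^ i)" "{..<d}" 1]
    by (simp add: abs_trace_def power_mult[symmetric] mult.commute)
  moreover have "(\<Sum>i<d. x ^ (2 ^ Suc i)) - abs_trace d x = x ^ (2 ^ d) - x"
    unfolding abs_trace_def sum_subtractf[symmetric]
    using sum_lessThan_telescope[of "\<lambda>i. x ^ (2 ^ i)" d] by simp
  ultimately show ?thesis by (simp add: minus_CHAR_2[OF assms])
qed

lemma abs_trace_in_prime_field:
  fixes x :: "'a::idom"
  assumes "CHAR('a) = 2" "x \<in> frob_fixed d"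
  shows "abs_trace d x = 0 \<or> abs_trace d x = 1"
  using abs_trace_square_add[OF assms(1), of d x] add_self_CHAR_2[OF assms(1), of x]
  by (simp add: frob_fixedD[OF assms(2)] square_add_eq_0_iff_CHAR_2[OF assms(1)])

lemma abs_trace_frobenius:
  fixes x :: "'a::idom"
  assumes "CHAR('a) = 2" "x \<in> frob_fixed d"
  shows "abs_trace d (x ^ (2 ^ k)) = abs_trace d x"
proof -
  have "abs_trace d (x ^ (2 ^ k)) = (abs_trace d x) ^ (2 ^ k)"
    by (simp add: abs_trace_def frobenius_sum[OF assms(1)] frobenius_comp add.commute)
  then show ?thesis using abs_trace_in_prime_field[OF assms] by auto
qed

definition trace_char :: "nat \<Rightarrow> 'a::comm_ring_1 \<Rightarrow> int" where
  "trace_char d x = (if abs_trace d x = 0 then 1 else - 1)"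

lemma trace_char_mult_self [simp]: "trace_char d x * trace_char d x = 1"
  by (simp add: trace_char_def)

lemma trace_char_eq_1_iff [simp]: "trace_char d x = 1 \<longleftrightarrow> abs_trace d x = 0"
  by (simp add: trace_char_def)

lemma trace_char_add:
  fixes x y :: "'a::idom"
  assumes "CHAR('a) = 2" "x \<in> frob_fixed d" "y \<in> frob_fixed d"
  shows "trace_char d (x + y) = trace_char d x * trace_char d y"
  using abs_trace_in_prime_field[OF assms(1,2)] abs_trace_in_prime_field[OF assms(1,3)]
    add_self_CHAR_2[OF assms(1), of 1]
  by (auto simp: trace_char_def abs_trace_add[OF assms(1)])

lemma trace_char_frobenius:
  fixes x :: "'a::idom"
  assumes "CHAR('a) = 2" "x \<in> frob_fixed d"
  shows "trace_char d (x ^ (2 ^ k)) = trace_char d x"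
  by (simp add: trace_char_def abs_trace_frobenius[OF assms])

section \<open>Sums of characters and of quadratic forms\<close>

lemma bij_betw_add_closed:
  fixes A :: "'a::cancel_semigroup_add set"
  assumes "finite A" "\<And>x y. x \<in> A \<Longrightarrow> y \<in> A \<Longrightarrow> x + y \<in> A" "a \<in> A"
  shows "bij_betw ((+) a) A A"
proof -
  have "inj_on ((+) a) A" by (simp add: inj_on_def)
  moreover have "(+) a ` A \<subseteq> A" using assms by auto
  ultimately show ?thesis using endo_inj_surj[OF \<open>finite A\<close>] by (simp add: bij_betw_def)
qed

lemma sum_additive_character:
  fixes \<chi> :: "'a::cancel_semigroup_add \<Rightarrow> 'b::idom"
  assumes "finite A" and closed: "\<And>x y. x \<in> A \<Longrightarrow> y \<in> A \<Longrightarrow> x + y \<in> A"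
    and character: "\<And>x y. x \<in> A \<Longrightarrow> y \<in> A \<Longrightarrow> \<chi> (x + y) = \<chi> x * \<chi> y"
  shows "(\<Sum>x\<in>A. \<chi> x) = (if \<forall>x\<in>A. \<chi> x = 1 then of_nat (card A) else 0)"
proof (cases "\<forall>x\<in>A. \<chi> x = 1")
  case False
  then obtain a where nontrivial: "a \<in> A" "\<chi> a \<noteq> 1" by auto
  have "(\<Sum>x\<in>A. \<chi> x) = (\<Sum>x\<in>A. \<chi> (a + x))"
    by (rule sum.reindex_bij_betw[symmetric]) (rule bij_betw_add_closed[OF assms(1,2) nontrivial(1)])
  also have "\<dots> = \<chi> a * (\<Sum>x\<in>A. \<chi> x)"
    by (simp add: character nontrivial(1) sum_distrib_left)
  finally have "(1 - \<chi> a) * (\<Sum>x\<in>A. \<chi> x) = 0" by (simp add: algebra_simps)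
  then have "(\<Sum>x\<in>A. \<chi> x) = 0" using nontrivial(2) by simp
  then show ?thesis using False by (simp only: if_False)
qed simp

text \<open>
  Read \<open>\<phi> = (-1) ^ Q\<close> for a quadratic form \<open>Q\<close> over the field of two elements, with polar form \<open>\<beta>\<close>;
  the right-hand sum extends over the radical.
\<close>

lemma sum_quadratic_character_square:
  fixes \<phi> :: "'a::cancel_semigroup_add \<Rightarrow> int"
  assumes "finite A" and closed: "\<And>x y. x \<in> A \<Longrightarrow> y \<in> A \<Longrightarrow> x + y \<in> A"
    and sign: "\<And>x. x \<in> A \<Longrightarrow> \<phi> x * \<phi> x = 1"
    and polar: "\<And>x z. x \<in> A \<Longrightarrow> z \<in> A \<Longrightarrow> \<phi> (x + z) = \<phi> x * \<phi> z * \<beta> x z"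
    and additive: "\<And>x y z. x \<in> A \<Longrightarrow> y \<in> A \<Longrightarrow> z \<in> A \<Longrightarrow> \<beta> (x + y) z = \<beta> x z * \<beta> y z"
  shows "(\<Sum>x\<in>A. \<phi> x)\<^sup>2 = int (card A) * (\<Sum>z | z \<in> A \<and> (\<forall>x\<in>A. \<beta> x z = 1). \<phi> z)"
proof -
  have "(\<Sum>x\<in>A. \<phi> x)\<^sup>2 = (\<Sum>x\<in>A. \<Sum>y\<in>A. \<phi> x * \<phi> y)"
    by (simp add: power2_eq_square sum_product)
  also have "\<dots> = (\<Sum>x\<in>A. \<Sum>z\<in>A. \<phi> x * \<phi> (x + z))"
    by (intro sum.cong refl sum.reindex_bij_betw[symmetric] bij_betw_add_closed assms(1) closed)
  also have "\<dots> = (\<Sum>x\<in>A. \<Sum>z\<in>A. \<phi> z * \<beta> x z)"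
    by (intro sum.cong refl) (simp add: polar mult.assoc[symmetric] sign)
  also have "\<dots> = (\<Sum>z\<in>A. \<phi> z * (\<Sum>x\<in>A. \<beta> x z))"
    by (subst sum.swap) (simp add: sum_distrib_left)
  also have "\<dots> = (\<Sum>z\<in>A. int (card A) * (if \<forall>x\<in>A. \<beta> x z = 1 then \<phi> z else 0))"
    by (intro sum.cong refl) (simp add: sum_additive_character[OF assms(1) closed] additive)
  also have "\<dots> = int (card A) * (\<Sum>z | z \<in> A \<and> (\<forall>x\<in>A. \<beta> x z = 1). \<phi> z)"
    by (simp add: sum.inter_filter[OF assms(1)] sum_distrib_left)
  finally show ?thesis .
qed

section \<open>Finite multiplicative groups in a domain\<close>

lemma bij_betw_mult_closed:
  fixes A :: "'a::idom set"
  assumes "finite A" "0 \<notin> A" "\<And>x y. x \<in> A \<Longrightarrow> y \<in> A \<Longrightarrow> x * y \<in> A" "a \<in> A"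
  shows "bij_betw ((*) a) A A"
proof -
  have "a \<noteq> 0" using assms(2,4) by auto
  then have "inj_on ((*) a) A" by (simp add: inj_on_def)
  moreover have "(*) a ` A \<subseteq> A" using assms by auto
  ultimately show ?thesis using endo_inj_surj[OF \<open>finite A\<close>] by (simp add: bij_betw_def)
qed

lemma power_card_eq_1:
  fixes A :: "'a::idom set"
  assumes "finite A" "0 \<notin> A" and closed: "\<And>x y. x \<in> A \<Longrightarrow> y \<in> A \<Longrightarrow> x * y \<in> A" and "a \<in> A"
  shows "a ^ card A = 1"
proof -
  have "(\<Prod>x\<in>A. x) = (\<Prod>x\<in>A. a * x)"
    by (rule prod.reindex_bij_betw[symmetric]) (rule bij_betw_mult_closed[OF assms])
  also have "\<dots> = a ^ card A * (\<Prod>x\<in>A. x)" by (simp add: prod.distrib)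
  finally show ?thesis using assms(1,2) by auto
qed

lemma sum_power_eq_0:
  fixes A :: "'a::idom set"
  assumes "finite A" "0 \<notin> A" and closed: "\<And>x y. x \<in> A \<Longrightarrow> y \<in> A \<Longrightarrow> x * y \<in> A"
    and not_dvd: "\<not> card A dvd e"
  shows "(\<Sum>x\<in>A. x ^ e) = 0"
proof (cases "A = {}")
  case False
  define r where "r = e mod card A"
  have power_r: "x ^ e = x ^ r" if "x \<in> A" for x
  proof -
    have "x ^ e = (x ^ card A) ^ (e div card A) * x ^ r"
      by (simp add: r_def power_mult[symmetric] power_add[symmetric])
    then show ?thesis using power_card_eq_1[OF assms(1-3) that] by simp
  qed
  have "0 < r" using not_dvd by (auto simp: r_def dvd_eq_mod_eq_0)
  have "r < card A" using False \<open>finite A\<close> by (simp add: r_def card_gt_0_iff)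
  have "\<exists>a\<in>A. a ^ r \<noteq> 1"
  proof (rule ccontr)
    assume "\<not> ?thesis"
    then have "poly (monom 1 r) x = poly 1 x" if "x \<in> A" for x
      using that by (simp add: poly_monom)
    then have "monom 1 r = (1 :: 'a poly)"
      using \<open>r < card A\<close> by (intro poly_eqI_degree[of A]) (simp_all add: degree_monom_eq)
    then show False using \<open>0 < r\<close> degree_monom_eq[of "1::'a" r] by simp
  qed
  then obtain a where nontrivial: "a \<in> A" "a ^ r \<noteq> 1" by auto
  have "(\<Sum>x\<in>A. x ^ e) = (\<Sum>x\<in>A. (a * x) ^ e)"
    by (rule sum.reindex_bij_betw[symmetric]) (rule bij_betw_mult_closed[OF assms(1-3) nontrivial(1)])
  also have "\<dots> = a ^ r * (\<Sum>x\<in>A. x ^ e)"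
    by (simp add: power_mult_distrib sum_distrib_left power_r[OF nontrivial(1)])
  finally have "(1 - a ^ r) * (\<Sum>x\<in>A. x ^ e) = 0" by (simp add: algebra_simps)
  then show ?thesis using nontrivial(2) by simp
qed simp

lemma finite_field_power_CARD: "x ^ CARD('k) = x" for x :: "'k::{finite,field}"
proof (cases "x = 0")
  case False
  have "x ^ CARD('k) = x ^ card (UNIV - {0::'k}) * x"
    using power_Suc2[of x "CARD('k) - 1"] by (simp add: card_Diff_singleton)
  also have "x ^ card (UNIV - {0::'k}) = 1" using False by (intro power_card_eq_1) auto
  finally show ?thesis by simp
qed simp

section \<open>Traces and additive characters of finite fields of characteristic two\<close>

definition artin_schreier :: "nat \<Rightarrow> 'a::comm_ring_1 \<Rightarrow> 'a" where
  "artin_schreier m x = x ^ (2 ^ m) + x"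

lemma artin_schreier_0 [simp]: "artin_schreier m 0 = 0"
  by (simp add: artin_schreier_def power_0_left)

lemma artin_schreier_add:
  "CHAR('a) = 2 \<Longrightarrow> artin_schreier m (x + y) = artin_schreier m x + artin_schreier m y"
  for x y :: "'a::comm_ring_1"
  by (simp add: artin_schreier_def frobenius_add add_ac)

lemma artin_schreier_eq_0_iff:
  "CHAR('a) = 2 \<Longrightarrow> artin_schreier m x = 0 \<longleftrightarrow> x \<in> frob_fixed m" for x :: "'a::comm_ring_1"
  by (simp add: artin_schreier_def frob_fixed_def add_eq_0_iff_CHAR_2)

lemma artin_schreier_fibre:
  fixes y :: "'a::comm_ring_1"
  assumes "CHAR('a) = 2"
  shows "{x. artin_schreier m x = artin_schreier m y} = (+) y ` frob_fixed m"
proof (intro equalityI subsetI)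
  fix x assume "x \<in> {x. artin_schreier m x = artin_schreier m y}"
  then have "y + x \<in> frob_fixed m"
    by (simp add: artin_schreier_add[OF assms] add_self_CHAR_2[OF assms]
        flip: artin_schreier_eq_0_iff[OF assms])
  moreover have "x = y + (y + x)" by (simp add: add_add_cancel_CHAR_2[OF assms])
  ultimately show "x \<in> (+) y ` frob_fixed m" by (rule rev_image_eqI)
qed (auto simp: artin_schreier_add[OF assms] simp flip: artin_schreier_eq_0_iff[OF assms])

lemma artin_schreier_closed:
  "CHAR('a) = 2 \<Longrightarrow> x \<in> frob_fixed d \<Longrightarrow> artin_schreier m x \<in> frob_fixed d"
  for x :: "'a::comm_ring_1"
  by (simp add: artin_schreier_def frob_fixed_add frob_fixed_power)

lemma artin_schreier_scale:
  "c \<in> frob_fixed m \<Longrightarrow> artin_schreier m (c * x) = c * artin_schreier m x"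
  by (simp add: artin_schreier_def power_mult_distrib frob_fixedD distrib_left)

locale binary_field =
  fixes ty :: "'k::{finite,field} itself" and n :: nat
  assumes card_K: "CARD('k) = 2 ^ n"
begin

lemma CHAR_K: "CHAR('k) = 2"
proof -
  have "CHAR('k) dvd 2 ^ n" using CHAR_dvd_CARD[where 'a = 'k] by (simp add: card_K)
  moreover have "prime CHAR('k)" by (rule prime_CHAR_semidom) (simp add: finite_imp_CHAR_pos)
  ultimately show ?thesis by (metis prime_dvd_power primes_dvd_imp_eq two_is_prime_nat)
qed

lemmas add_self = add_self_CHAR_2[OF CHAR_K]
  and add_add_cancel = add_add_cancel_CHAR_2[OF CHAR_K]
  and add_eq_0_iff = add_eq_0_iff_CHAR_2[OF CHAR_K]
  and frob_fixed_add_K = frob_fixed_add[OF CHAR_K]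
  and artin_schreier_add_K = artin_schreier_add[OF CHAR_K]

lemma n_pos: "n > 0"
proof (rule ccontr)
  assume "\<not> n > 0"
  then have "card {0, 1::'k} \<le> 1" using card_mono[of UNIV "{0, 1::'k}"] by (simp add: card_K)
  then show False by simp
qed

lemma frob_fixed_UNIV: "(frob_fixed n :: 'k set) = UNIV"
  using finite_field_power_CARD[where 'k = 'k] by (auto simp: frob_fixed_def card_K)

lemma power_two_power_eq_iff: "x ^ (2 ^ k) = y ^ (2 ^ k) \<longleftrightarrow> x = y" for x y :: 'k
proof -
  have "x ^ (2 ^ k) = y ^ (2 ^ k) \<longleftrightarrow> (x + y) ^ (2 ^ k) = 0"
    by (simp only: frobenius_add[OF CHAR_K] add_eq_0_iff)
  then show ?thesis by (simp add: add_eq_0_iff)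
qed

lemma card_power_sum_fibre:
  assumes "r > 0" "d > 0"
  shows "card {x::'k. (\<Sum>i<r. x ^ (2 ^ (d * i))) = c} \<le> 2 ^ (d * (r - 1))"
proof -
  define p :: "'k poly" where "p = (\<Sum>i<r. monom 1 (2 ^ (d * i))) - [:c:]"
  have "coeff p (2 ^ (d * (r - 1))) = (\<Sum>i<r. if i = r - 1 then 1 else 0)"
    using assms by (auto simp: p_def coeff_sum coeff_pCons split: nat.splits intro!: sum.cong)
  then have "p \<noteq> 0" using assms by (auto simp: sum.delta)
  moreover have "degree p \<le> 2 ^ (d * (r - 1))"
    unfolding p_def
  proof (intro degree_diff_le degree_sum_le)
    fix i assume "i \<in> {..<r}"
    then show "degree (monom (1::'k) (2 ^ (d * i))) \<le> 2 ^ (d * (r - 1))"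
      by (auto simp: degree_monom_eq intro!: power_increasing mult_le_mono)
  qed auto
  moreover have "{x. (\<Sum>i<r. x ^ (2 ^ (d * i))) = c} = {x. poly p x = 0}"
    by (auto simp: p_def poly_sum poly_monom)
  ultimately show ?thesis using card_poly_roots_bound[of p] by auto
qed

text \<open>Both bounds count the fibres of power sums: that of \<open>x + x^(2^d)\<close> and the relative trace.\<close>

lemma card_frob_fixed:
  assumes "d dvd n"
  shows "card (frob_fixed d :: 'k set) = 2 ^ d"
proof (rule antisym)
  obtain r where n_eq: "n = d * r" using assms by auto
  then have positive: "d > 0" "r > 0" using n_pos by auto
  have "frob_fixed d = {x::'k. (\<Sum>i<2. x ^ (2 ^ (d * i))) = 0}"
    by (auto simp: frob_fixed_def numeral_2_eq_2 add_eq_0_iff)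
  then show "card (frob_fixed d :: 'k set) \<le> 2 ^ d"
    using card_power_sum_fibre[of 2 d 0] positive by simp
  define rel_trace where "rel_trace x = (\<Sum>i<r. x ^ (2 ^ (d * i)))" for x :: 'k
  have "rel_trace x ^ (2 ^ d) - rel_trace x = x ^ (2 ^ (d * r)) - x ^ (2 ^ (d * 0))" for x
    using sum_lessThan_telescope[of "\<lambda>i. x ^ (2 ^ (d * i))" r]
    by (simp add: rel_trace_def frobenius_sum[OF CHAR_K] frobenius_comp add.commute sum_subtractf)
  then have "rel_trace x ^ (2 ^ d) - rel_trace x = 0" for x
    using frob_fixedD[of x n] frob_fixed_UNIV n_eq by simp
  then have "rel_trace \<in> UNIV \<rightarrow> frob_fixed d" by (simp add: frob_fixed_def)
  then obtain y where "CARD('k) \<le> card (rel_trace -` {y} \<inter> UNIV) * card (frob_fixed d :: 'k set)"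
    using pigeonhole_card[of rel_trace UNIV "frob_fixed d"] frob_fixed_0[of d] by fastforce
  also have "card (rel_trace -` {y} \<inter> UNIV) \<le> 2 ^ (d * (r - 1))"
    using card_power_sum_fibre[OF positive(2,1), of y] by (simp add: rel_trace_def vimage_def)
  finally have "CARD('k) \<le> 2 ^ (d * (r - 1)) * card (frob_fixed d :: 'k set)" by simp
  moreover have "CARD('k) = 2 ^ (d * (r - 1)) * 2 ^ d"
    using card_K n_eq positive(2) by (simp add: power_add[symmetric] algebra_simps)
  ultimately show "2 ^ d \<le> card (frob_fixed d :: 'k set)" by simp
qed

lemma ex_trace_mult_nonzero:
  assumes "d dvd n" and w_unit: "w \<in> frob_fixed d" "(w::'k) \<noteq> 0"
  shows "\<exists>x \<in> frob_fixed d. abs_trace d (x * w) \<noteq> 0"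
proof -
  have "d > 0" using \<open>d dvd n\<close> n_pos by (auto intro: Nat.gr0I)
  then have "card {x::'k. abs_trace d x = 0} \<le> 2 ^ (d - 1)"
    using card_power_sum_fibre[of d 1 0] by (simp add: abs_trace_def)
  then have "card {x::'k. abs_trace d x = 0} < card (frob_fixed d :: 'k set)"
    using \<open>d > 0\<close> by (simp add: card_frob_fixed[OF \<open>d dvd n\<close>] le_less_trans)
  then have "\<not> frob_fixed d \<subseteq> {x::'k. abs_trace d x = 0}"
    by (meson card_mono finite leD)
  then obtain x where "x \<in> frob_fixed d" "abs_trace d (x::'k) \<noteq> 0" by auto
  then show ?thesis using w_unit by (intro bexI[of _ "x / w"]) (auto simp: frob_fixed_divide)
qed

lemma trace_char_add_K:
  "(x::'k) \<in> frob_fixed d \<Longrightarrow> y \<in> frob_fixed d \<Longrightarrow> trace_char d (x + y) = trace_char d x * trace_char d y"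
  by (rule trace_char_add[OF CHAR_K])

lemma sum_trace_char_mult:
  assumes "(w::'k) \<in> frob_fixed d" "S \<subseteq> frob_fixed d"
    and "\<And>x y. x \<in> S \<Longrightarrow> y \<in> S \<Longrightarrow> x + y \<in> S"
  shows "(\<Sum>x\<in>S. trace_char d (x * w)) = (if \<forall>x\<in>S. abs_trace d (x * w) = 0 then int (card S) else 0)"
  using assms sum_additive_character[of S "\<lambda>x. trace_char d (x * w)"]
  by (simp add: distrib_right trace_char_add_K frob_fixed_mult subset_iff)

lemma sum_trace_char:
  assumes "d dvd n" "(w::'k) \<in> frob_fixed d"
  shows "(\<Sum>x\<in>frob_fixed d. trace_char d (x * w)) = (if w = 0 then 2 ^ d else 0)"
  using sum_trace_char_mult[OF assms(2) subset_refl] ex_trace_mult_nonzero[OF assms]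
  by (auto simp: frob_fixed_add_K card_frob_fixed[OF assms(1)])

lemma ex_trace_annihilator:
  assumes "d dvd n" and S_subgroup: "S \<subseteq> frob_fixed d" "0 \<in> S" "\<And>x y. x \<in> S \<Longrightarrow> y \<in> S \<Longrightarrow> x + y \<in> S"
    and small: "card S < 2 ^ d"
  shows "\<exists>c \<in> frob_fixed d. c \<noteq> (0::'k) \<and> (\<forall>s\<in>S. abs_trace d (s * c) = 0)"
proof (rule ccontr)
  assume none: "\<not> ?thesis"
  have "2 ^ d = (\<Sum>s\<in>S. if s = 0 then 2 ^ d else (0::int))"
    using S_subgroup(2) by (simp add: sum.delta)
  also have "\<dots> = (\<Sum>s\<in>S. \<Sum>c\<in>frob_fixed d. trace_char d (c * s))"
    using S_subgroup(1) by (intro sum.cong refl) (simp add: sum_trace_char[OF \<open>d dvd n\<close>] subset_iff)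
  also have "\<dots> = (\<Sum>c\<in>frob_fixed d. \<Sum>s\<in>S. trace_char d (s * c))"
    by (subst sum.swap) (simp add: mult.commute)
  also have "\<dots> = (\<Sum>c\<in>frob_fixed d. if (c::'k) = 0 then int (card S) else 0)"
  proof (intro sum.cong refl)
    fix c :: 'k assume c_fixed: "c \<in> frob_fixed d"
    have "(\<forall>s\<in>S. abs_trace d (s * c) = 0) \<longleftrightarrow> c = 0" using none c_fixed by auto
    then show "(\<Sum>s\<in>S. trace_char d (s * c)) = (if c = 0 then int (card S) else 0)"
      using sum_trace_char_mult[OF c_fixed S_subgroup(1,3)] by simp
  qed
  also have "\<dots> = int (card S)" by (simp add: sum.delta frob_fixed_0)
  finally have "int (2 ^ d) = int (card S)" by simp
  then show False using small by (metis less_irrefl of_nat_eq_iff)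
qed

lemma sum_trace_char_subfield:
  fixes w :: 'k
  assumes "m dvd n"
  shows "(\<Sum>c\<in>frob_fixed m. trace_char n (c * w))
    = (if \<forall>c\<in>frob_fixed m. abs_trace n (c * w) = 0 then 2 ^ m else 0)"
  using sum_trace_char_mult[of w n "frob_fixed m"] card_frob_fixed[OF assms]
  by (simp add: frob_fixed_UNIV frob_fixed_add_K)

text \<open>
  The image is contained in the set on the right, and both have \<open>2 ^ (n - m)\<close> elements, the former
  because the fibres are the cosets of \<open>frob_fixed m\<close>, the latter by orthogonality.
\<close>

lemma range_artin_schreier:
  assumes "m dvd n"
  shows "range (artin_schreier m) = {w::'k. \<forall>c\<in>frob_fixed m. abs_trace n (c * w) = 0}"
    (is "?image = ?dual")
proof (rule card_seteq)
  show "?image \<subseteq> ?dual"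
  proof clarify
    fix y c :: 'k assume "c \<in> frob_fixed m"
    then have "c * artin_schreier m y = (c * y) ^ (2 ^ m) + c * y"
      by (simp add: artin_schreier_def power_mult_distrib frob_fixedD distrib_left)
    then show "abs_trace n (c * artin_schreier m y) = 0"
      using abs_trace_frobenius[OF CHAR_K, of "c * y" n m] frob_fixed_UNIV
      by (simp add: abs_trace_add[OF CHAR_K] add_self)
  qed
  have "int (2 ^ m * card ?dual) = (\<Sum>w\<in>UNIV. if w \<in> ?dual then int (2 ^ m) else 0)"
    by (simp add: sum.inter_filter[symmetric])
  also have "\<dots> = (\<Sum>w\<in>UNIV. \<Sum>c\<in>frob_fixed m. trace_char n (c * (w::'k)))"
    by (intro sum.cong refl) (simp add: sum_trace_char_subfield[OF assms])
  also have "\<dots> = (\<Sum>c\<in>frob_fixed m. \<Sum>w\<in>frob_fixed n. trace_char n (w * (c::'k)))"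
    by (subst sum.swap) (simp add: mult.commute frob_fixed_UNIV)
  also have "\<dots> = (\<Sum>c\<in>frob_fixed m. if (c::'k) = 0 then int (2 ^ n) else 0)"
    by (intro sum.cong refl, subst sum_trace_char) (simp_all add: frob_fixed_UNIV)
  also have "\<dots> = int (2 ^ n)" by (simp add: sum.delta frob_fixed_0)
  finally have card_dual: "2 ^ m * card ?dual = CARD('k)" by (simp only: of_nat_eq_iff card_K)
  obtain y :: 'k where "CARD('k) \<le> card (artin_schreier m -` {artin_schreier m y} \<inter> UNIV) * card ?image"
    using pigeonhole_card[of "artin_schreier m" UNIV ?image] by auto
  also have "card (artin_schreier m -` {artin_schreier m y} \<inter> UNIV) = 2 ^ m"
    using card_frob_fixed[OF assms]
    by (simp add: vimage_def artin_schreier_fibre[OF CHAR_K] card_image)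
  finally have "2 ^ m * card ?dual \<le> 2 ^ m * card ?image" by (simp only: card_dual)
  then show "card ?dual \<le> card ?image" by simp
qed simp

lemma sum_trace_char_line:
  fixes w :: 'k
  assumes "m dvd n"
  shows "(\<Sum>c\<in>frob_fixed m. trace_char n (c * w)) = (if w \<in> range (artin_schreier m) then 2 ^ m else 0)"
  by (simp add: range_artin_schreier[OF assms] sum_trace_char_subfield[OF assms])

end

section \<open>The quadratic character of two\<close>

text \<open>The Jacobi symbol \<open>(2/k)\<close>, meaningful for odd \<open>k\<close> only.\<close>

definition jacobi_2 :: "nat \<Rightarrow> int" where
  "jacobi_2 k = (if k mod 8 = 1 \<or> k mod 8 = 7 then 1 else - 1)"

lemma jacobi_2_mult:
  assumes "odd k" "odd l"
  shows "jacobi_2 (k * l) = jacobi_2 k * jacobi_2 l"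
proof -
  have "k mod 8 \<in> {1, 3, 5, 7}" "l mod 8 \<in> {1, 3, 5, 7}" using assms by (auto, presburger+)
  then show ?thesis
    unfolding jacobi_2_def mod_mult_eq[of k 8 l, symmetric] by (elim insertE emptyE) simp_all
qed

lemma jacobi_2_mult_self [simp]: "jacobi_2 k * jacobi_2 k = 1"
  by (simp add: jacobi_2_def)

lemma even_half_minus_quarter_iff:
  assumes "odd p"
  shows "even ((p - 1) div 2 - (p - 1) div 2 div 2) \<longleftrightarrow> p mod 8 = 1 \<or> p mod 8 = (7::nat)"
proof -
  define k where "k = p div 8"
  have "p = 8 * k + 1 \<or> p = 8 * k + 3 \<or> p = 8 * k + 5 \<or> p = 8 * k + 7"
    using assms unfolding k_def by presburger
  then show ?thesis by (elim disjE) (simp_all, presburger)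
qed

lemma two_power_half_cong_jacobi_2:
  assumes odd_prime: "prime p" "odd p"
  shows "[2 ^ ((p - 1) div 2) = jacobi_2 p] (mod int p)"
proof -
  have "p > 2" using odd_prime prime_ge_2_nat[of p] by (cases "p = 2") auto
  then interpret GAUSS p 2 using odd_prime by unfold_locales (auto simp: cong_def)
  define h where "h = (p - 1) div 2"
  have h_eq: "int p = 2 * int h + 1" "(int p - 1) div 2 = int h"
    using odd_prime(2) \<open>p > 2\<close> by (auto simp: h_def elim!: oddE)
  have "x * 2 mod int p = x * 2" if "x \<in> {0<..int h}" for x using that h_eq(1) by simp
  then have "C = (\<lambda>x. x * 2) ` {0<..int h}"
    by (auto simp: C_def B_def A_def image_image h_eq(2) intro!: image_cong)
  moreover have "int h < x * 2 \<longleftrightarrow> int (h div 2) < x" for x by presburger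
  ultimately have "E = (\<lambda>x. x * 2) ` {int (h div 2)<..int h}"
    by (auto simp: E_def h_eq(2))
  then have "card E = h - h div 2" by (simp add: card_image inj_on_def)
  moreover have "even (h - h div 2) \<longleftrightarrow> p mod 8 = 1 \<or> p mod 8 = 7"
    unfolding h_def by (rule even_half_minus_quarter_iff[OF odd_prime(2)])
  ultimately have "(- 1) ^ card E = jacobi_2 p" by (simp add: jacobi_2_def)
  then have "[2 ^ h = jacobi_2 p] (mod int p)" using pre_gauss_lemma by (simp add: h_eq(2))
  then show ?thesis by (simp only: h_def)
qed

lemma eq_if_square_eq_and_cong:
  fixes x y :: int
  assumes "x\<^sup>2 = y\<^sup>2" "[x = y] (mod k)" "\<not> k dvd 2 * y"
  shows "x = y"
  using assms by (auto simp: power2_eq_iff cong_iff_dvd_diff)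

section \<open>The exponential sums of the Suzuki curve\<close>

locale suzuki = binary_field ty n for ty :: "'k::{finite,field} itself" and n +
  fixes a m q0 q :: nat
  assumes m_def: "m = 2 * a + 1" and q0_def: "q0 = 2 ^ a" and q_def: "q = 2 ^ m" and m_dvd: "m dvd n"
begin

definition rhs :: "'k \<Rightarrow> 'k" where
  "rhs x = x ^ q0 * artin_schreier m x"

lemma power_q0_add: "(x + y) ^ q0 = x ^ q0 + y ^ q0" for x y :: 'k
  by (simp add: q0_def frobenius_add[OF CHAR_K])

lemma artin_schreier_eq: "artin_schreier m x = x ^ q + x"
  by (simp add: artin_schreier_def q_def)

lemma rhs_add: "rhs (x + z) = rhs x + rhs z + (x ^ q0 * artin_schreier m z + z ^ q0 * artin_schreier m x)"
  by (simp add: rhs_def power_q0_add artin_schreier_add_K algebra_simps)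

lemma rhs_closed: "x \<in> frob_fixed d \<Longrightarrow> rhs x \<in> frob_fixed d"
  by (simp add: rhs_def frob_fixed_closed artin_schreier_closed[OF CHAR_K])

lemma rhs_frobenius: "rhs (x ^ (2 ^ k)) = rhs x ^ (2 ^ k)"
  by (simp add: rhs_def artin_schreier_def power_mult_distrib frobenius_add[OF CHAR_K]
      power_mult[symmetric] mult.commute)

lemma rhs_scale: "z \<in> frob_fixed m \<Longrightarrow> rhs (z * x) = z ^ (q0 + 1) * rhs x"
  by (simp add: rhs_def artin_schreier_scale power_mult_distrib)

lemma trace_polar_form:
  fixes x z :: 'k
  assumes x_fixed: "x \<in> frob_fixed e" and z_fixed: "z \<in> frob_fixed e"
  defines "h \<equiv> artin_schreier m z"
  shows "abs_trace e (x ^ q0 * h + z ^ q0 * artin_schreier m x) = abs_trace e (x ^ q * (h\<^sup>2 + h) ^ q0)"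
proof -
  have h_fixed: "h \<in> frob_fixed e"
    using z_fixed by (simp add: h_def artin_schreier_closed[OF CHAR_K])
  note trace_frobenius = abs_trace_frobenius[OF CHAR_K, symmetric]
  have "abs_trace e (x ^ q0 * h) = abs_trace e ((x ^ q0 * h) ^ (2 ^ (a + 1)))"
    by (rule trace_frobenius) (simp add: x_fixed h_fixed frob_fixed_closed)
  also have "(x ^ q0 * h) ^ (2 ^ (a + 1)) = x ^ q * (h\<^sup>2) ^ q0"
    by (simp only: power_mult_distrib q0_def q_def m_def frobenius_comp mult_2)
      (simp add: power_mult[symmetric] add_ac)
  finally have first_summand: "abs_trace e (x ^ q0 * h) = abs_trace e (x ^ q * (h\<^sup>2) ^ q0)" .
  have "abs_trace e (z ^ q0 * x) = abs_trace e ((z ^ q0 * x) ^ (2 ^ m))"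
    by (rule trace_frobenius) (simp add: x_fixed z_fixed frob_fixed_closed)
  also have "(z ^ q0 * x) ^ (2 ^ m) = x ^ q * (z ^ q) ^ q0"
    by (simp add: power_mult_distrib q_def power_mult[symmetric] mult.commute)
  finally have second_summand: "abs_trace e (z ^ q0 * x) = abs_trace e (x ^ q * (z ^ q) ^ q0)" .
  have "x ^ q * (h\<^sup>2 + h) ^ q0 = x ^ q * (h\<^sup>2) ^ q0 + (x ^ q * (z ^ q) ^ q0 + x ^ q * z ^ q0)"
    by (simp add: h_def artin_schreier_eq power_q0_add distrib_left)
  then show ?thesis
    by (simp add: artin_schreier_eq[of x] distrib_left[of "z ^ q0"] abs_trace_add[OF CHAR_K]
        first_summand second_summand mult.commute[of "z ^ q0" "x ^ q"] add_ac)
qed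

end

locale suzuki4 = suzuki ty n a m q0 q for ty :: "'k::{finite,field} itself" and n a m q0 q +
  assumes n_def: "n = 4 * m"
begin

definition rhs_sum :: "nat \<Rightarrow> int" where
  "rhs_sum d = (\<Sum>x\<in>frob_fixed (4 * d). trace_char (4 * d) (rhs x))"

lemma four_mult_dvd_n: "d dvd m \<Longrightarrow> 4 * d dvd n"
  using n_def by simp

lemma odd_dvd_m: "d dvd m \<Longrightarrow> odd d"
  using m_def by (metis dvd_trans even_mult_iff even_plus_one_iff dvd_triv_left)

lemma ex_artin_schreier_eq_1: "\<exists>w::'k. w \<in> frob_fixed 2 \<and> artin_schreier m w = 1"
proof -
  have "card (frob_fixed 2 :: 'k set) = 4" using card_frob_fixed[of 2] n_def by simp
  then have "\<not> (frob_fixed 2 :: 'k set) \<subseteq> {0, 1}"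
    using card_mono[of "{0, 1::'k}" "frob_fixed 2"] by auto
  then obtain w :: 'k where w_new: "w \<in> frob_fixed 2" "w \<noteq> 0" "w \<noteq> 1" by auto
  have "(w\<^sup>2 + w)\<^sup>2 + (w\<^sup>2 + w) = (w ^ 4 + w) + (w\<^sup>2 + w\<^sup>2)"
    by (simp add: power2_add_CHAR_2[OF CHAR_K] add_ac)
  also have "\<dots> = 0" using frob_fixedD[OF w_new(1)] by (simp add: add_self)
  finally have "w\<^sup>2 + w = 1" using w_new by (simp add: square_add_eq_0_iff_CHAR_2[OF CHAR_K])
  moreover have "m mod 2 = 1" using odd_dvd_m[OF dvd_refl] by presburger
  then have "w ^ (2 ^ m) = w\<^sup>2" using frob_fixed_mod[OF w_new(1), of m] by simp
  ultimately show ?thesis using w_new(1) by (auto simp: artin_schreier_def)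
qed

lemma frob_fixed_4_Int_m:
  assumes "d dvd m"
  shows "frob_fixed (4 * d) \<inter> frob_fixed m = (frob_fixed d :: 'k set)"
proof -
  obtain j where m_eq: "m = d * j" using assms by auto
  then have "odd j" using odd_dvd_m[of j] by simp
  then have "coprime 4 j" using coprime_power_left_iff[of 2 2 j] by simp
  then have "gcd (4 * d) m = d"
    by (metis m_eq gcd_mult_distrib_nat mult.commute coprime_imp_gcd_eq_1 mult_1_right)
  then show ?thesis by (simp add: frob_fixed_Int)
qed

definition rhs_radical :: "nat \<Rightarrow> 'k set" where
  "rhs_radical d = {z \<in> frob_fixed (4 * d). artin_schreier m z = 0 \<or> artin_schreier m z = 1}"

lemma rhs_radical_eq:
  assumes "d dvd m" "w \<in> frob_fixed 2" "artin_schreier m w = 1"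
  shows "rhs_radical d = frob_fixed d \<union> (+) w ` frob_fixed d"
proof -
  have w_fixed: "w \<in> frob_fixed (4 * d)" using assms(2) frob_fixed_mono[of 2 "4 * d"] by auto
  have "artin_schreier m z = 1 \<longleftrightarrow> z \<in> (+) w ` frob_fixed m" for z
    using artin_schreier_fibre[OF CHAR_K, of m w] assms(3) by auto
  moreover have "w + c \<in> frob_fixed (4 * d) \<longleftrightarrow> c \<in> frob_fixed (4 * d)" for c
    using w_fixed frob_fixed_add_K[of w "4 * d" "w + c"] frob_fixed_add_K[of w "4 * d" c]
    by (auto simp: add_add_cancel)
  ultimately have "rhs_radical d
      = frob_fixed (4 * d) \<inter> frob_fixed m \<union> (+) w ` (frob_fixed (4 * d) \<inter> frob_fixed m)"
    by (auto simp: rhs_radical_def artin_schreier_eq_0_iff[OF CHAR_K])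
  then show ?thesis by (simp only: frob_fixed_4_Int_m[OF assms(1)])
qed

lemma card_rhs_radical:
  assumes "d dvd m"
  shows "card (rhs_radical d) = 2 ^ (d + 1)"
proof -
  obtain w :: 'k where w_root: "w \<in> frob_fixed 2" "artin_schreier m w = 1"
    using ex_artin_schreier_eq_1 by auto
  have kernel: "artin_schreier m x = 0" if "x \<in> frob_fixed d" for x :: 'k
    using that frob_fixed_mono[OF assms] by (auto simp: artin_schreier_eq_0_iff[OF CHAR_K])
  then have "artin_schreier m (w + x) = 1" if "x \<in> frob_fixed d" for x
    using that w_root(2) by (simp add: artin_schreier_add_K)
  with kernel have "frob_fixed d \<inter> (+) w ` frob_fixed d = {}" by fastforce
  then show ?thesis
    using card_frob_fixed[of d] dvd_trans[OF assms m_dvd]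
    by (simp add: rhs_radical_eq[OF assms w_root] card_Un_disjoint card_image)
qed

lemma trace_rhs_radical:
  assumes "d dvd m" and z_radical: "z \<in> rhs_radical d"
  shows "abs_trace (4 * d) (rhs z) = 0"
proof (cases "artin_schreier m z = 0")
  case False
  then have "rhs z = z ^ q0" using z_radical by (simp add: rhs_radical_def rhs_def)
  moreover have "z \<in> frob_fixed (2 * d)"
  proof -
    obtain w :: 'k where w_root: "w \<in> frob_fixed 2" "artin_schreier m w = 1"
      using ex_artin_schreier_eq_1 by auto
    have "frob_fixed 2 \<subseteq> (frob_fixed (2 * d) :: 'k set)" "frob_fixed d \<subseteq> (frob_fixed (2 * d) :: 'k set)"
      by (simp_all add: frob_fixed_mono)
    then show ?thesis
      using z_radical w_root(1) rhs_radical_eq[OF assms(1) w_root]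
      by (auto intro!: frob_fixed_add_K)
  qed
  then have "abs_trace (2 * d * 2) (z ^ q0) = of_nat 2 * abs_trace (2 * d) (z ^ q0)"
    by (intro abs_trace_mult_degree frob_fixed_power)
  moreover have "of_nat 2 = (0::'k)" using of_nat_CHAR[where 'a = 'k] by (simp only: CHAR_K)
  ultimately show ?thesis by (simp add: mult.commute)
qed (simp add: rhs_def)

lemma rhs_radical_iff:
  assumes "d dvd m" and z_fixed: "z \<in> frob_fixed (4 * d)"
  defines "v \<equiv> ((artin_schreier m z)\<^sup>2 + artin_schreier m z) ^ q0"
  shows "z \<in> rhs_radical d \<longleftrightarrow> (\<forall>x\<in>frob_fixed (4 * d). trace_char (4 * d) (x ^ q * v) = 1)"
proof -
  have "v \<in> frob_fixed (4 * d)"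
    using z_fixed
    by (simp add: v_def frob_fixed_closed frob_fixed_add_K artin_schreier_closed[OF CHAR_K])
  have "(\<forall>x\<in>frob_fixed (4 * d). trace_char (4 * d) (x ^ q * v) = 1)
      \<longleftrightarrow> (\<forall>y\<in>(\<lambda>x. x ^ q) ` frob_fixed (4 * d). abs_trace (4 * d) (y * v) = 0)"
    by simp
  also have "(\<lambda>x::'k. x ^ q) ` frob_fixed (4 * d) = frob_fixed (4 * d)"
    by (rule endo_inj_surj) (auto simp: q_def frob_fixed_power inj_on_def power_two_power_eq_iff)
  also have "(\<forall>y\<in>frob_fixed (4 * d). abs_trace (4 * d) (y * v) = 0) \<longleftrightarrow> v = 0"
    using ex_trace_mult_nonzero[OF four_mult_dvd_n[OF assms(1)] \<open>v \<in> frob_fixed (4 * d)\<close>] by auto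
  also have "\<dots> \<longleftrightarrow> z \<in> rhs_radical d"
    using z_fixed by (simp add: v_def q0_def rhs_radical_def square_add_eq_0_iff_CHAR_2[OF CHAR_K])
  finally show ?thesis by blast
qed

lemma rhs_sum_square:
  assumes "d dvd m"
  shows "(rhs_sum d)\<^sup>2 = 2 ^ (5 * d + 1)"
proof -
  define e where "e = 4 * d"
  let ?E = "frob_fixed e :: 'k set"
  define v where "v z = ((artin_schreier m z)\<^sup>2 + artin_schreier m z) ^ q0" for z :: 'k
  have v_fixed: "v z \<in> ?E" if "z \<in> ?E" for z
    using that
    by (simp add: v_def frob_fixed_closed frob_fixed_add_K artin_schreier_closed[OF CHAR_K])
  have polar: "trace_char e (rhs (x + z))
      = trace_char e (rhs x) * trace_char e (rhs z) * trace_char e (x ^ q * v z)"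
    if "x \<in> ?E" "z \<in> ?E" for x z
  proof -
    let ?b = "x ^ q0 * artin_schreier m z + z ^ q0 * artin_schreier m x"
    have "?b \<in> ?E"
      using that by (simp add: frob_fixed_closed frob_fixed_add_K artin_schreier_closed[OF CHAR_K])
    then have "trace_char e (rhs (x + z)) = trace_char e (rhs x) * trace_char e (rhs z) * trace_char e ?b"
      unfolding rhs_add using that by (simp add: trace_char_add_K frob_fixed_add_K rhs_closed)
    then show ?thesis using trace_polar_form[OF that] by (simp add: trace_char_def v_def)
  qed
  have "(rhs_sum d)\<^sup>2 = int (card ?E) *
      (\<Sum>z | z \<in> ?E \<and> (\<forall>x\<in>?E. trace_char e (x ^ q * v z) = 1). trace_char e (rhs z))"
    unfolding rhs_sum_def e_def[symmetric]
  proof (rule sum_quadratic_character_square)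
    fix x y z assume xyz_fixed: "x \<in> ?E" "y \<in> ?E" "z \<in> ?E"
    have "(x + y) ^ q * v z = x ^ q * v z + y ^ q * v z"
      by (simp add: q_def frobenius_add[OF CHAR_K] distrib_right)
    then show "trace_char e ((x + y) ^ q * v z) = trace_char e (x ^ q * v z) * trace_char e (y ^ q * v z)"
      using xyz_fixed v_fixed by (simp add: trace_char_add_K frob_fixed_closed)
  qed (simp_all add: polar frob_fixed_add_K)
  also have "{z \<in> ?E. \<forall>x\<in>?E. trace_char e (x ^ q * v z) = 1} = rhs_radical d"
    using rhs_radical_iff[OF assms] by (auto simp: e_def v_def rhs_radical_def)
  also have "(\<Sum>z\<in>rhs_radical d. trace_char e (rhs z)) = int (card (rhs_radical d))"
    by (simp add: trace_char_def e_def trace_rhs_radical[OF assms])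
  also have "card ?E = 2 ^ e"
    unfolding e_def by (rule card_frob_fixed[OF four_mult_dvd_n[OF assms]])
  finally show ?thesis by (simp add: card_rhs_radical[OF assms] e_def power_add[symmetric])
qed

end

context suzuki4
begin

lemma rhs_sum_cong:
  assumes "d * p dvd m" and prime_p: "prime p"
  shows "[rhs_sum (d * p) = rhs_sum d] (mod int p)"
proof -
  let ?frob = "\<lambda>x::'k. x ^ (2 ^ (4 * d))" and ?e = "4 * (d * p)"
  let ?E = "frob_fixed ?e :: 'k set"
  have "[(\<Sum>x\<in>?E. trace_char ?e (rhs x)) = (\<Sum>x | x \<in> ?E \<and> ?frob x = x. trace_char ?e (rhs x))] (mod int p)"
  proof (rule sum_cong_sum_fixed_points[OF _ prime_p])
    fix x assume x_fixed: "x \<in> ?E"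
    show "(?frob ^^ p) x = x"
      using frob_fixedD[OF x_fixed] by (simp add: funpow_frobenius mult.assoc)
    show "trace_char ?e (rhs (?frob x)) = trace_char ?e (rhs x)"
      by (simp add: rhs_frobenius trace_char_frobenius[OF CHAR_K rhs_closed[OF x_fixed]])
  qed (simp_all add: frob_fixed_power)
  also have "{x \<in> ?E. ?frob x = x} = frob_fixed (4 * d)"
    using frob_fixed_mono[of "4 * d" ?e] by (auto simp: frob_fixed_def[of "4 * d"])
  also have "(\<Sum>x\<in>frob_fixed (4 * d). trace_char ?e (rhs x)) = rhs_sum d"
    unfolding rhs_sum_def
  proof (intro sum.cong refl)
    fix x :: 'k assume x_fixed: "x \<in> frob_fixed (4 * d)"
    have "odd p" using odd_dvd_m[OF assms(1)] by simp
    then have "of_nat p = (1::'k)"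
      using of_nat_CHAR[where 'a = 'k] by (elim oddE) (simp add: CHAR_K)
    then show "trace_char ?e (rhs x) = trace_char (4 * d) (rhs x)"
      using abs_trace_mult_degree[OF rhs_closed[OF x_fixed], of p]
      by (simp add: trace_char_def mult.assoc)
  qed
  finally show ?thesis by (simp add: rhs_sum_def)
qed

lemma trace4_frob_fixed_2: "(x::'k) \<in> frob_fixed 2 \<Longrightarrow> abs_trace 4 x = 0"
  using abs_trace_mult_degree[of x 2 2] of_nat_CHAR[where 'a = 'k] by (simp add: CHAR_K)

lemma trace4_gold:
  fixes x :: 'k
  assumes x_fixed: "x \<in> frob_fixed 4"
  shows "abs_trace 4 (x * x ^ (2 ^ i))
    = (if i mod 4 = 0 then abs_trace 4 x else if i mod 4 = 2 then 0 else abs_trace 4 (x ^ 3))"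
proof -
  have power_16: "x ^ 16 = x" using frob_fixedD[OF x_fixed] by simp
  have power2: "abs_trace 4 (y\<^sup>2) = abs_trace 4 y" if "y \<in> frob_fixed 4" for y :: 'k
    using abs_trace_frobenius[OF CHAR_K that, of 1] by simp
  have reduce: "x ^ (2 ^ i) = x ^ (2 ^ (i mod 4))" by (rule frob_fixed_mod[OF x_fixed, symmetric])
  consider (zero) "i mod 4 = 0" | (one) "i mod 4 = 1" | (two) "i mod 4 = 2" | (three) "i mod 4 = 3"
    by linarith
  then show ?thesis
  proof cases
    case zero
    with reduce show ?thesis using power2[OF x_fixed] by (simp add: power2_eq_square)
  next
    case one
    with reduce show ?thesis by (simp add: power2_eq_square power3_eq_cube mult.assoc)
  next
    case two
    have "(x ^ 5) ^ 4 = x ^ 16 * x ^ 4" by (simp flip: power_mult power_add)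
    then have "x ^ 5 \<in> frob_fixed 2" using power_16 by (simp add: frob_fixed_def flip: power_Suc)
    with two reduce show ?thesis using trace4_frob_fixed_2 by (simp flip: power_Suc)
  next
    case three
    have "(x ^ 9)\<^sup>2 = x ^ 16 * x\<^sup>2" by (simp flip: power_mult power_add)
    then have "(x ^ 9)\<^sup>2 = x ^ 3" using power_16 by (simp add: power2_eq_square power3_eq_cube)
    then have "abs_trace 4 (x ^ 9) = abs_trace 4 (x ^ 3)"
      using power2[OF frob_fixed_power[OF x_fixed, of 9]] by simp
    with three reduce show ?thesis by (simp flip: power_Suc)
  qed
qed

lemma trace4_rhs:
  assumes x_fixed: "x \<in> frob_fixed 4"
  shows "abs_trace 4 (rhs x) = abs_trace 4 (x ^ 3) + (if jacobi_2 m = 1 then abs_trace 4 x else 0)"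
proof -
  have "rhs x = x ^ q0 * x ^ (2 ^ m) + x * x ^ q0"
    by (simp add: rhs_def artin_schreier_def distrib_left mult.commute[of x])
  also have "x ^ q0 * x ^ (2 ^ m) = (x * x ^ (2 ^ Suc a)) ^ (2 ^ a)"
    by (simp only: power_mult_distrib frobenius_comp q0_def m_def) (simp add: mult_2)
  also have "x * x ^ q0 = x * x ^ (2 ^ a)" by (simp only: q0_def)
  finally have "abs_trace 4 (rhs x) = abs_trace 4 (x * x ^ (2 ^ Suc a)) + abs_trace 4 (x * x ^ (2 ^ a))"
    using abs_trace_frobenius[OF CHAR_K, of "x * x ^ (2 ^ Suc a)" 4 a] x_fixed
    by (simp only: abs_trace_add[OF CHAR_K] frob_fixed_closed)
  moreover have "jacobi_2 m = 1 \<longleftrightarrow> a mod 4 = 0 \<or> a mod 4 = 3"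
    unfolding jacobi_2_def m_def by presburger
  moreover have "a mod 4 = 0 \<or> a mod 4 = 1 \<or> a mod 4 = 2 \<or> a mod 4 = 3" by linarith
  ultimately show ?thesis unfolding trace4_gold[OF x_fixed] by (auto simp: mod_Suc)
qed

lemma trace4_cube:
  fixes x :: 'k
  assumes "x \<in> frob_fixed 4" "x \<notin> frob_fixed 2"
  shows "abs_trace 4 (x ^ 3) = 1"
proof -
  define z where "z = x ^ 3"
  have "x \<noteq> 0" using assms(2) by (auto simp: frob_fixed_0)
  have "x * x ^ 15 = x * 1" using assms(1) by (simp add: frob_fixed_def flip: power_Suc)
  then have z_power_5: "z ^ 5 = 1" using \<open>x \<noteq> 0\<close> by (simp add: z_def flip: power_mult)
  have "x * z \<noteq> x * 1" using assms(2) by (simp add: frob_fixed_def z_def flip: power_Suc)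
  then have "z \<noteq> 1" by auto
  have "(z - 1) * (1 + (z + z\<^sup>2 + z ^ 3 + z ^ 4)) = z ^ 5 - 1"
    by (simp add: power_numeral_reduce algebra_simps)
  then have "z + z\<^sup>2 + z ^ 3 + z ^ 4 = 1" using \<open>z \<noteq> 1\<close> z_power_5 by (simp add: add_eq_0_iff)
  moreover have "z ^ 8 = z ^ 5 * z ^ 3" by (simp flip: power_add)
  ultimately show ?thesis
    by (simp add: abs_trace_def z_power_5 z_def[symmetric] lessThan_nat_numeral power2_eq_square add_ac)
qed

lemma trace_char_4_rhs:
  assumes "x \<in> frob_fixed 4"
  shows "trace_char 4 (rhs x) = (if x \<in> frob_fixed 2 then 1
    else if jacobi_2 m = 1 then - trace_char 4 x else - 1)"
proof (cases "x \<in> frob_fixed 2")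
  case True
  then show ?thesis
    by (simp add: trace_char_def trace4_rhs[OF assms] trace4_frob_fixed_2 frob_fixed_power)
next
  case False
  then show ?thesis
    using abs_trace_in_prime_field[OF CHAR_K assms] add_self[of 1]
    by (auto simp: trace_char_def trace4_rhs[OF assms] trace4_cube[OF assms])
qed

lemma rhs_sum_1: "rhs_sum 1 = 8 * jacobi_2 m"
proof -
  let ?E2 = "frob_fixed 2 :: 'k set" and ?E4 = "frob_fixed 4 :: 'k set"
  have "2 dvd n" "4 dvd n" using n_def by auto
  have subset: "?E2 \<subseteq> ?E4" by (simp add: frob_fixed_mono)
  have cards: "card ?E2 = 4" "card ?E4 = 16"
    using card_frob_fixed[OF \<open>2 dvd n\<close>] card_frob_fixed[OF \<open>4 dvd n\<close>] by simp_all
  have sum_split: "(\<Sum>x\<in>?E4. g x) = (\<Sum>x\<in>?E4 - ?E2. g x) + (\<Sum>x\<in>?E2. g x)" for g :: "'k \<Rightarrow> int"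
    using sum.subset_diff[OF subset, of g] by simp
  have "rhs_sum 1 = (\<Sum>x\<in>?E4 - ?E2. if jacobi_2 m = 1 then - trace_char 4 x else - 1) + (\<Sum>x\<in>?E2. 1)"
    unfolding rhs_sum_def mult_1_right sum_split
    by (intro arg_cong2[where f = "(+)"] sum.cong refl) 
      (use subset in \<open>auto simp: trace_char_4_rhs simp del: trace_char_eq_1_iff\<close>)
  also have "\<dots> = 8 * jacobi_2 m"
  proof (cases "jacobi_2 m = 1")
    case True
    have "(\<Sum>x\<in>?E4. trace_char 4 x) = 0"
      using sum_trace_char[OF \<open>4 dvd n\<close>, of 1] by (simp add: frob_fixed_1)
    moreover have "(\<Sum>x\<in>?E2. trace_char 4 x) = 4"
      using cards by (simp add: trace_char_def trace4_frob_fixed_2)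
    ultimately show ?thesis using True cards sum_split[of "trace_char 4"] by (simp add: sum_negf)
  next
    case False
    then have "jacobi_2 m = - 1" by (simp add: jacobi_2_def split: if_splits)
    then show ?thesis using cards card_Diff_subset[OF _ subset] by simp
  qed
  finally show ?thesis .
qed

lemma rhs_sum_prime_step:
  assumes "d * p dvd m" and prime_p: "prime p"
    and rhs_sum_d: "rhs_sum d = jacobi_2 d * jacobi_2 m * 2 ^ ((5 * d + 1) div 2)"
  shows "rhs_sum (d * p) = jacobi_2 (d * p) * jacobi_2 m * 2 ^ ((5 * (d * p) + 1) div 2)"
    (is "_ = ?t")
proof (rule eq_if_square_eq_and_cong)
  have odd_d_p: "odd d" "odd p" using odd_dvd_m[OF assms(1)] by auto
  then obtain u v where d_p_eq: "d = 2 * u + 1" "p = 2 * v + 1" by (metis oddE)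
  then have exponent_eq: "(5 * (d * p) + 1) div 2 = (5 * d + 1) div 2 + (p - 1) div 2 * (5 * d)"
    by (simp add: algebra_simps)
  have "?t\<^sup>2 = (2 ^ ((5 * (d * p) + 1) div 2))\<^sup>2"
    by (simp add: power_mult_distrib power2_eq_square[of "jacobi_2 _"])
  also have "(5 * (d * p) + 1) div 2 * 2 = 5 * (d * p) + 1"
    by (rule dvd_div_mult_self) (use odd_d_p in simp)
  then have "((2::int) ^ ((5 * (d * p) + 1) div 2))\<^sup>2 = 2 ^ (5 * (d * p) + 1)"
    by (simp only: power_mult[symmetric])
  finally show "(rhs_sum (d * p))\<^sup>2 = ?t\<^sup>2" by (simp only: rhs_sum_square[OF assms(1)])
  have "[?t = jacobi_2 (d * p) * jacobi_2 m * (2 ^ ((5 * d + 1) div 2) * jacobi_2 p ^ (5 * d))] (mod int p)"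
    unfolding exponent_eq power_add power_mult
    by (intro cong_mult cong_refl cong_pow two_power_half_cong_jacobi_2 prime_p odd_d_p(2))
  also have "jacobi_2 p ^ (5 * d) = jacobi_2 p" using odd_d_p(1) by (simp add: jacobi_2_def)
  also have "jacobi_2 (d * p) * jacobi_2 m * (2 ^ ((5 * d + 1) div 2) * jacobi_2 p) = rhs_sum d"
    using jacobi_2_mult_self[of p] by (simp add: rhs_sum_d jacobi_2_mult[OF odd_d_p] mult_ac)
  finally show "[rhs_sum (d * p) = ?t] (mod int p)"
    using rhs_sum_cong[OF assms(1) prime_p] cong_trans cong_sym by blast
  have "\<bar>2 * ?t\<bar> = int (2 ^ Suc ((5 * (d * p) + 1) div 2))" by (simp add: abs_mult jacobi_2_def)
  moreover have "\<not> p dvd 2 ^ k" for k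
    using odd_d_p(2) prime_p
    by (metis even_numeral prime_dvd_power primes_dvd_imp_eq two_is_prime_nat)
  ultimately show "\<not> int p dvd 2 * ?t" by (metis dvd_abs_iff int_dvd_int_iff)
qed

lemma rhs_sum_eq:
  assumes "d dvd m"
  shows "rhs_sum d = jacobi_2 d * jacobi_2 m * 2 ^ ((5 * d + 1) div 2)"
  using assms
proof (induction d rule: less_induct)
  case (less d)
  show ?case
  proof (cases "d = 1")
    case True
    then show ?thesis using rhs_sum_1 by (simp add: jacobi_2_def[of "Suc 0"])
  next
    case False
    then obtain p where prime_factor: "prime p" "p dvd d" using prime_factor_nat by blast
    then obtain e where d_eq: "d = e * p" by (metis dvdE mult.commute)
    have "e > 0" using odd_dvd_m[OF less.prems] d_eq by (auto intro: Nat.gr0I)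
    then have "e < d" using d_eq prime_gt_1_nat[OF prime_factor(1)] by simp
    then show ?thesis
      unfolding d_eq using less d_eq
      by (intro rhs_sum_prime_step[OF _ prime_factor(1)]) (auto dest: dvd_mult_left)
  qed
qed

lemma rhs_sum_m: "rhs_sum m = 2 * int q0 * int q ^ 2"
proof -
  have "(5 * m + 1) div 2 = Suc (a + m * 2)" unfolding m_def by simp
  then have "rhs_sum m = 2 ^ Suc (a + m * 2)" by (simp add: rhs_sum_eq)
  also have "\<dots> = 2 * int q0 * int q ^ 2" by (simp add: q0_def q_def power_add power_mult)
  finally show ?thesis .
qed

end

section \<open>Points on the Suzuki curve\<close>

context suzuki
begin

lemma q_pos: "q > 0" "q0 > 0" "q \<ge> 2"
  by (auto simp: q_def q0_def m_def)

lemma q_eq: "q = 2 * q0 * q0"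
  by (simp add: q_def q0_def m_def power_add mult_2 distrib_right)

lemma card_Fq: "card (frob_fixed m :: 'k set) = q"
  using card_frob_fixed[OF m_dvd] by (simp add: q_def)

lemma card_Fq_units: "card (frob_fixed m - {0::'k}) = q - 1"
  by (simp add: card_Diff_singleton frob_fixed_0 card_Fq)

lemma power_q_minus_1_eq_1: "z \<in> frob_fixed m \<Longrightarrow> z \<noteq> 0 \<Longrightarrow> z ^ (q - 1) = 1" for z :: 'k
  using power_card_eq_1[of "frob_fixed m - {0::'k}" z] by (simp add: card_Fq_units frob_fixed_mult)

text \<open>The inverse of \<open>q0 + 1\<close> modulo \<open>q - 1\<close> is \<open>- 2 (q0 - 1)\<close>.\<close>

lemma ex_root_Fq:
  assumes "c \<in> frob_fixed m" "(c::'k) \<noteq> 0"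
  shows "\<exists>z \<in> frob_fixed m. z \<noteq> 0 \<and> z ^ (q0 + 1) = c"
proof -
  obtain k where q0_eq: "q0 = Suc k" using q_pos(2) gr0_implies_Suc by blast
  define z where "z = 1 / c ^ (2 * k)"
  have "2 * k * (q0 + 1) + 1 = q - 1" by (simp add: q_eq q0_eq algebra_simps)
  then have "c ^ (2 * k * (q0 + 1)) * c = 1"
    using power_q_minus_1_eq_1[OF assms] power_Suc2[of c "2 * k * (q0 + 1)"] by simp
  then have "z ^ (q0 + 1) = c"
    using assms(2) by (simp only: z_def power_divide power_one power_mult[symmetric])
      (simp add: divide_eq_eq mult.commute)
  moreover have "z \<in> frob_fixed m" "z \<noteq> 0"
    using assms by (simp_all add: z_def frob_fixed_divide frob_fixed_closed)
  ultimately show ?thesis by blast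
qed

definition abscissas :: "'k set" where
  "abscissas = {x. x \<noteq> 0 \<and> rhs x \<in> range (artin_schreier m)}"

end

context suzuki4
begin

lemma sum_trace_char_scaled_rhs:
  assumes "c \<in> frob_fixed m"
  shows "(\<Sum>x\<in>UNIV. trace_char n (c * rhs x)) = (if c = 0 then int q ^ 4 else rhs_sum m)"
proof (cases "c = 0")
  case True
  then show ?thesis using card_K by (simp add: q_def n_def mult.commute flip: power_mult)
next
  case False
  then obtain z where z_root: "z \<in> frob_fixed m" "z \<noteq> 0" "z ^ (q0 + 1) = c"
    using ex_root_Fq[OF assms] by auto
  have "(\<Sum>x\<in>UNIV. trace_char n (c * rhs x)) = (\<Sum>x\<in>UNIV. trace_char n (rhs (z * x)))"
    using rhs_scale[OF z_root(1)] z_root(3) by simp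
  also have "\<dots> = (\<Sum>x\<in>UNIV. trace_char n (rhs x))"
    by (rule sum.reindex_bij_witness[of _ "\<lambda>x. x / z" "\<lambda>x. z * x"]) (use z_root in auto)
  finally show ?thesis using False by (simp add: rhs_sum_def frob_fixed_UNIV flip: n_def)
qed

lemma card_rhs_in_range_artin_schreier:
  "int (card {x. rhs x \<in> range (artin_schreier m)}) = int q ^ 3 + 2 * int q0 * int q * (int q - 1)"
proof -
  let ?Z = "{x. rhs x \<in> range (artin_schreier m)}"
  have "int q * int (card ?Z) = (\<Sum>x\<in>UNIV. \<Sum>c\<in>frob_fixed m. trace_char n (c * rhs x))"
    by (simp add: sum_trace_char_line[OF m_dvd] q_def flip: sum.inter_filter)
  also have "\<dots> = (\<Sum>c\<in>frob_fixed m. if (c::'k) = 0 then int q ^ 4 else rhs_sum m)"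
    by (subst sum.swap) (simp add: sum_trace_char_scaled_rhs)
  also have "\<dots> = int q ^ 4 + (\<Sum>c\<in>frob_fixed m - {0::'k}. rhs_sum m)"
    by (subst sum.remove[of _ 0]) (auto simp: frob_fixed_0 intro!: sum.cong)
  also have "\<dots> = int q * (int q ^ 3 + 2 * int q0 * int q * (int q - 1))"
    using q_pos
    by (simp add: card_Fq_units rhs_sum_m of_nat_diff algebra_simps power_numeral_reduce)
  finally show ?thesis using q_pos by simp
qed

lemma card_abscissas: "card abscissas = (q - 1) * (q\<^sup>2 + 2 * q * q0 + q + 1)"
proof -
  let ?Z = "{x. rhs x \<in> range (artin_schreier m)}"
  have "0 \<in> ?Z" by (auto simp: rhs_def intro!: range_eqI[of _ _ 0])
  moreover have "abscissas = ?Z - {0}" by (auto simp: abscissas_def)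
  ultimately have "int (card ?Z) = int (card abscissas) + 1"
    using card.remove[of ?Z 0] by simp
  then have "int (card abscissas) = (int q - 1) * (int q ^ 2 + 2 * int q * int q0 + int q + 1)"
    by (simp add: card_rhs_in_range_artin_schreier algebra_simps power_numeral_reduce)
  also have "\<dots> = int ((q - 1) * (q\<^sup>2 + 2 * q * q0 + q + 1))" using q_pos
    by (simp only: of_nat_mult of_nat_add of_nat_diff of_nat_1 of_nat_power of_nat_numeral
        One_nat_def[symmetric])
  finally show ?thesis by (simp only: of_nat_eq_iff)
qed

end

section \<open>Power series in prime characteristic\<close>

lemma fps_power_CHAR_power_nth:
  fixes h :: "'a::comm_ring_1 fps"
  assumes "prime CHAR('a)" "q = CHAR('a) ^ j"
  shows "(h ^ q) $ k = (if q dvd k then (h $ (k div q)) ^ q else 0)"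
proof -
  have "q > 0" using prime_gt_0_nat[OF assms(1)] assms(2) by simp
  then have "k < Suc k * q" by (cases q) auto
  have "h = fps_X ^ Suc k * fps_shift (Suc k) h + fps_cutoff (Suc k) h"
    by (simp only: fps_shift_cutoff')
  then have "h ^ q = (fps_X ^ Suc k * fps_shift (Suc k) h) ^ q + fps_cutoff (Suc k) h ^ q"
    using freshmans_dream'[of q j "fps_X ^ Suc k * fps_shift (Suc k) h" "fps_cutoff (Suc k) h"] assms
    by simp
  also have "(fps_X ^ Suc k * fps_shift (Suc k) h) ^ q = fps_X ^ (Suc k * q) * fps_shift (Suc k) h ^ q"
    by (simp only: power_mult_distrib power_mult)
  finally have "(h ^ q) $ k = (fps_cutoff (Suc k) h ^ q) $ k"
    using \<open>k < Suc k * q\<close> by (simp add: fps_X_power_mult_nth)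
  also have "fps_cutoff (Suc k) h = (\<Sum>i\<le>k. fps_const (h $ i) * fps_X ^ i)"
    by (rule fps_ext) (simp add: fps_sum_nth if_distrib[of "(*) _"] less_Suc_eq_le cong: if_cong)
  also have "\<dots> ^ q = (\<Sum>i\<le>k. (fps_const (h $ i) * fps_X ^ i) ^ q)"
    by (rule freshmans_dream_sum'[of q j]) (simp_all add: assms)
  also have "\<dots> $ k = (\<Sum>i\<le>k. if i * q = k then (h $ i) ^ q else 0)"
    by (simp add: fps_sum_nth power_mult_distrib eq_commute[of k] if_distrib[of "(*) _"]
        flip: power_mult cong: if_cong)
  also have "\<dots> = (\<Sum>i\<le>k. if i = k div q then (if q dvd k then (h $ i) ^ q else 0) else 0)"
    using \<open>q > 0\<close> by (intro sum.cong refl) auto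
  also have "\<dots> = (if q dvd k then (h $ (k div q)) ^ q else 0)"
    by (simp add: sum.delta' div_le_dividend)
  finally show ?thesis .
qed

lemma ex_fps_artin_schreier:
  fixes u :: "'a::comm_ring_1 fps"
  assumes "prime CHAR('a)" and q_power: "q = CHAR('a) ^ j" "q > 1" and y_root: "y ^ q + y = u $ 0"
  shows "\<exists>h. h ^ q + h = u \<and> h $ 0 = y"
proof -
  define rec where "rec h i r \<longleftrightarrow>
    r = (if i = 0 then y else u $ i - (if q dvd i then h (i div q) ^ q else 0))"
    for h i and r :: 'a
  have "\<exists>h. \<forall>i. rec h i (h i)"
  proof (rule dependent_wellorder_choice)
    show "rec g i r = rec h i r" if "\<And>k. k < i \<Longrightarrow> g k = h k" for r g h i
      using that[of "i div q"] q_power(2) by (cases "i = 0") (simp_all add: rec_def)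
  qed (simp add: rec_def)
  then obtain h where h_rec: "\<And>i. rec h i (h i)" by blast
  have "(Abs_fps h ^ q + Abs_fps h) $ i = u $ i" for i
    using h_rec[of i] h_rec[of 0] y_root fps_power_CHAR_power_nth[OF assms(1) q_power(1), of "Abs_fps h" i]
    by (cases "i = 0") (simp_all add: rec_def)
  then have "Abs_fps h ^ q + Abs_fps h = u" by (simp add: fps_eq_iff)
  moreover have "Abs_fps h $ 0 = y" using h_rec[of 0] by (simp add: rec_def)
  ultimately show ?thesis by blast
qed

section \<open>Quadratic equations over a polynomial ring\<close>

text \<open>Along the exponents \<open>2 ^ i * k\<close> the coefficients of \<open>Q\<close> are determined by those of \<open>v\<close>.\<close>

lemma coeff_eq_0_if_square_add:
  fixes Q :: "'a::idom poly"
  assumes CHAR: "CHAR('a) = 2" and quadratic: "Q\<^sup>2 + Q = v" and "odd k"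
    and v_sparse: "\<And>i. i \<noteq> a \<Longrightarrow> coeff v (2 ^ i * k) = 0"
  shows "coeff v (2 ^ a * k) = 0"
proof -
  have "(fps_of_poly Q ^ 2) $ j = (if 2 dvd j then (fps_of_poly Q $ (j div 2)) ^ 2 else 0)" for j
    by (rule fps_power_CHAR_power_nth[of _ 1]) (simp_all add: CHAR)
  then have coeff_square: "coeff (Q\<^sup>2) j = (if even j then (coeff Q (j div 2))\<^sup>2 else 0)" for j
    by (simp only: fps_of_poly_power[symmetric] fps_of_poly_nth)
  define b where "b i = coeff Q (2 ^ i * k)" for i
  have coeff_Q: "coeff Q j = coeff v j - coeff (Q\<^sup>2) j" for j by (simp flip: quadratic)
  have b_0: "b 0 = coeff v (2 ^ 0 * k)"
    using coeff_Q[of k] \<open>odd k\<close> by (simp add: b_def coeff_square)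
  have b_Suc: "b (Suc i) = coeff v (2 ^ Suc i * k) - (b i)\<^sup>2" for i
    using coeff_Q[of "2 ^ Suc i * k"] by (simp add: b_def coeff_square mult.assoc)
  have "b i = 0" if "i < a" for i
    using that by (induction i) (simp_all only: b_0 b_Suc v_sparse, simp_all)
  then have b_a: "b a = coeff v (2 ^ a * k)"
    by (cases a) (simp_all only: b_0 b_Suc, simp_all)
  have nonzero: "b (a + i) \<noteq> 0" if "coeff v (2 ^ a * k) \<noteq> 0" for i
  proof (induction i)
    case 0
    then show ?case using that by (simp add: b_a)
  next
    case (Suc i)
    then show ?case using v_sparse[of "Suc (a + i)"] by (simp add: b_Suc)
  qed
  have "degree Q < 2 ^ degree Q" by simp
  also have "\<dots> \<le> 2 ^ (a + degree Q) * k"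
    using \<open>odd k\<close> by (auto simp: power_add elim!: oddE)
  finally show ?thesis using nonzero[of "degree Q"] coeff_eq_0 unfolding b_def by blast
qed

text \<open>
  The polynomial ring is integrally closed: replacing \<open>B\<close> by its remainder, assume
  \<open>degree B < degree A\<close>; then \<open>B\<^sup>2 + A * B\<close> is too small in degree to be a multiple of \<open>A\<^sup>2\<close>.
\<close>

lemma dvd_if_square_add_mult:
  fixes A B u :: "'a::field poly"
  assumes "CHAR('a) = 2" "A \<noteq> 0" and quadratic: "B\<^sup>2 + A * B = A\<^sup>2 * u"
  shows "A dvd B"
proof (rule ccontr)
  define Q R where "Q = B div A" and "R = B mod A"
  assume "\<not> A dvd B"
  then have "R \<noteq> 0" by (simp add: R_def dvd_eq_mod_eq_0)
  then have "degree R < degree A" using degree_mod_less[OF \<open>A \<noteq> 0\<close>, of B] by (simp add: R_def)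
  then have degree_sum: "R + A \<noteq> 0" "degree (R + A) = degree A"
    using degree_add_eq_right[of R A] by auto
  have "B = A * Q + R" by (simp add: Q_def R_def)
  then have "B\<^sup>2 + A * B = R * (R + A) + A\<^sup>2 * (Q\<^sup>2 + Q)"
    using power2_add_CHAR_2[of "A * Q" R] assms(1)
    by (simp add: power2_eq_square algebra_simps)
  then have factors: "R * (R + A) = A\<^sup>2 * (u - (Q\<^sup>2 + Q))"
    using quadratic by (simp add: algebra_simps)
  then have "u - (Q\<^sup>2 + Q) \<noteq> 0" using \<open>R \<noteq> 0\<close> degree_sum(1) by auto
  then have "degree (A\<^sup>2 * (u - (Q\<^sup>2 + Q))) \<ge> 2 * degree A"
    using \<open>A \<noteq> 0\<close> by (simp add: degree_mult_eq degree_power_eq)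
  moreover have "degree (R * (R + A)) = degree R + degree A"
    using \<open>R \<noteq> 0\<close> degree_sum by (simp add: degree_mult_eq)
  ultimately show False using \<open>degree R < degree A\<close> factors by simp
qed

section \<open>Artin-Schreier extensions of the rational function field\<close>

lemma degree_pcompose_linear_diff:
  fixes p :: "'a::idom poly"
  shows "pcompose p [:c, 1:] - p = 0 \<or> degree (pcompose p [:c, 1:] - p) < degree p"
proof (rule disjCI)
  let ?D = "pcompose p [:c, 1:] - p"
  have degree_eq: "degree (pcompose p [:c, 1:]) = degree p" by (simp add: degree_pcompose)
  have "coeff ?D (degree p) = 0" using lead_coeff_comp[of "[:c, 1:]" p] degree_eq by simp
  moreover have "degree ?D \<le> degree p" using degree_eq by (intro degree_diff_le) auto
  moreover assume "\<not> degree ?D < degree p"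
  ultimately show "?D = 0" using leading_coeff_0_iff[of ?D] by auto
qed

context comm_ring_hom
begin

lemma comm_ring_hom_eval_poly: "comm_ring_hom (\<lambda>G. eval_poly hom G y)"
proof -
  interpret map_poly_comm_ring_hom hom by unfold_locales
  show ?thesis by unfold_locales (simp_all add: eval_poly_def hom_distribs)
qed

lemma eval_poly_const: "eval_poly hom [:p:] y = hom p"
  by (simp add: eval_poly_def map_poly_pCons_hom)

lemma eval_poly_X: "eval_poly hom [:0, 1:] y = y"
  by (simp add: eval_poly_def map_poly_pCons_hom)

lemma eval_poly_smult: "eval_poly hom (smult p G) y = hom p * eval_poly hom G y"
  by (simp add: eval_poly_def map_poly_hom_smult)

lemma eval_poly_pcompose: "eval_poly hom (pcompose G H) y = eval_poly hom G (eval_poly hom H y)"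
  by (simp add: eval_poly_def map_poly_pcompose poly_pcompose)

lemma hom_abs_trace: "hom (abs_trace d x) = abs_trace d (hom x)"
  by (simp add: abs_trace_def hom_distribs)

end

definition artin_schreier_poly :: "nat \<Rightarrow> 'a::comm_ring_1 \<Rightarrow> 'a poly" where
  "artin_schreier_poly m u = monom 1 (2 ^ m) + monom 1 1 - [:u:]"

lemma degree_artin_schreier_poly:
  fixes u :: "'a::comm_ring_1"
  assumes "m > 0"
  shows "degree (artin_schreier_poly m u) = 2 ^ m" "lead_coeff (artin_schreier_poly m u) = 1"
proof -
  have "(2::nat) ^ 1 \<le> 2 ^ m" using assms by (intro power_increasing) auto
  then have "degree (monom (1::'a) 1 - [:u:]) < degree (monom (1::'a) (2 ^ m))"
    by (intro le_less_trans[OF degree_diff_le[of _ 1]]) (auto simp: degree_monom_eq)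
  then show degree_eq: "degree (artin_schreier_poly m u) = 2 ^ m"
    by (simp add: artin_schreier_poly_def add_diff_eq[symmetric] degree_add_eq_left degree_monom_eq)
  show "lead_coeff (artin_schreier_poly m u) = 1"
    unfolding degree_eq using \<open>2 ^ 1 \<le> 2 ^ m\<close>
    by (auto simp: artin_schreier_poly_def coeff_pCons split: nat.splits)
qed

locale artin_schreier_curve = binary_field ty n
  for ty :: "'k::{finite,field} itself" and n :: nat +
  fixes m :: nat and u :: "'k poly"
  assumes m_dvd: "m dvd n" and no_quadratic_root: "c \<noteq> 0 \<Longrightarrow> artin_schreier 1 Q \<noteq> smult c u"
begin

abbreviation f :: "'k poly poly" where
  "f \<equiv> artin_schreier_poly m u"

lemma m_pos: "m > 0"
  using m_dvd n_pos by (auto intro: Nat.gr0I)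

lemma f_nonzero: "f \<noteq> 0"
  using degree_artin_schreier_poly(1)[OF m_pos, of u] by auto

end

locale artin_schreier_extension =
  artin_schreier_curve ty n m u + emb: inj_comm_ring_hom emb
  for ty :: "'k::{finite,field} itself" and n m :: nat and u :: "'k poly"
    and emb :: "'k poly \<Rightarrow> 'd::idom" +
  fixes eta :: 'd
  assumes eta: "artin_schreier m eta = emb u"
begin

interpretation eval: comm_ring_hom "\<lambda>G. eval_poly emb G y" for y
  by (rule emb.comm_ring_hom_eval_poly)

interpretation const: comm_ring_hom "\<lambda>c. emb [:c:]"
  by unfold_locales (simp_all flip: emb.hom_add emb.hom_mult add: one_pCons[symmetric])

lemma CHAR_d: "CHAR('d) = 2"
proof -
  have "of_nat 2 = (0::'k)" using of_nat_CHAR[where 'a = 'k] by (simp only: CHAR_K)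
  then have "of_nat 2 = (0::'d)" using const.hom_of_nat[of 2] by simp
  then have "CHAR('d) dvd 2" by (simp only: of_nat_eq_0_iff_char_dvd)
  then show ?thesis 
    using CHAR_not_1'[where 'a = 'd] two_is_prime_nat by (auto simp: prime_nat_iff)
qed

lemma eval_f: "eval_poly emb f y = artin_schreier m y - emb u"
  by (simp add: artin_schreier_poly_def artin_schreier_def hom_distribs emb.eval_poly_monom
      emb.eval_poly_const)

lemma emb_const_frob_fixed: "c \<in> frob_fixed d \<Longrightarrow> emb [:c:] \<in> frob_fixed d"
  by (simp add: frob_fixed_def flip: const.hom_power)

lemma eval_f_conjugate:
  assumes "c \<in> frob_fixed m"
  shows "eval_poly emb f (eta + emb [:c:]) = 0"
  using emb_const_frob_fixed[OF assms]
  by (simp add: eval_f eta artin_schreier_add[OF CHAR_d] flip: artin_schreier_eq_0_iff[OF CHAR_d])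

lemma eval_f_eta: "eval_poly emb f eta = 0"
  by (simp add: eval_f eta)

definition conjugate_shifts :: "'k poly poly \<Rightarrow> 'k set" where
  "conjugate_shifts G = {c \<in> frob_fixed m. eval_poly emb G (eta + emb [:c:]) = 0}"

definition minimal_annihilator :: "'k poly poly \<Rightarrow> bool" where
  "minimal_annihilator D \<longleftrightarrow> eval_poly emb D eta = 0 \<and> D \<noteq> 0 \<and>
     (\<forall>G. eval_poly emb G eta = 0 \<longrightarrow> G \<noteq> 0 \<longrightarrow> degree D \<le> degree G)"

lemma ex_minimal_annihilator:
  assumes "eval_poly emb G eta = 0" "G \<noteq> 0"
  shows "\<exists>D. minimal_annihilator D"
  using ex_has_least_nat[of "\<lambda>G. eval_poly emb G eta = 0 \<and> G \<noteq> 0" G degree] assms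
  unfolding minimal_annihilator_def by blast

lemma minimal_annihilator_eq_0:
  assumes "minimal_annihilator D" "eval_poly emb G eta = 0" "G = 0 \<or> degree G < degree D"
  shows "G = 0"
  using assms unfolding minimal_annihilator_def by (meson not_le)

lemma minimal_annihilator_degree_pos:
  assumes "minimal_annihilator D"
  shows "degree D > 0"
proof (rule ccontr)
  assume "\<not> degree D > 0"
  then obtain p where "D = [:p:]" by (metis degree_eq_zeroE neq0_conv)
  then show False using assms by (simp add: minimal_annihilator_def emb.eval_poly_const)
qed

lemma card_conjugate_shifts_le:
  assumes "G \<noteq> 0"
  shows "card (conjugate_shifts G) \<le> degree G"
proof -
  have "map_poly emb G \<noteq> 0" using assms by (simp add: poly_eq_iff coeff_map_poly)
  note roots = poly_roots_finite[OF this] card_poly_roots_bound[OF this]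
  have "card (conjugate_shifts G) = card ((\<lambda>c. eta + emb [:c:]) ` conjugate_shifts G)"
    by (intro card_image[symmetric]) (simp add: inj_on_def)
  also have "\<dots> \<le> card {y. poly (map_poly emb G) y = 0}"
    using roots(1) by (intro card_mono) (auto simp: conjugate_shifts_def eval_poly_def)
  finally show ?thesis using roots(2) by simp
qed

lemma degree_le_card_conjugate_shifts:
  assumes "minimal_annihilator D"
  shows "degree D \<le> card (conjugate_shifts D)"
proof -
  have annihilator: "D \<noteq> 0" "eval_poly emb D eta = 0"
    using assms by (auto simp: minimal_annihilator_def)
  obtain A H R where division: "A \<noteq> 0" "smult A f = D * H + R" "R = 0 \<or> degree R < degree D"
    using pseudo_mod[OF annihilator(1), of f] by blast
  have "eval_poly emb R eta = 0"
    using arg_cong[OF division(2), of "\<lambda>G. eval_poly emb G eta"] annihilator(2)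
    by (simp add: emb.eval_poly_smult eval.hom_add eval.hom_mult eval_f_eta)
  then have "R = 0" using division(3) by (rule minimal_annihilator_eq_0[OF assms])
  then have factors: "smult A f = D * H" using division(2) by simp
  then have "H \<noteq> 0" using division(1) f_nonzero by auto
  then have degree_sum: "degree D + degree H = 2 ^ m"
    using factors degree_mult_eq[OF annihilator(1)] division(1) degree_artin_schreier_poly(1)[OF m_pos, of u]
    by (metis degree_smult_eq)
  have "frob_fixed m \<subseteq> conjugate_shifts D \<union> conjugate_shifts H"
  proof
    fix c :: 'k assume c_fixed: "c \<in> frob_fixed m"
    have "eval_poly emb D (eta + emb [:c:]) * eval_poly emb H (eta + emb [:c:]) = 0"
      using arg_cong[OF factors, of "\<lambda>G. eval_poly emb G (eta + emb [:c:])"]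
      by (simp add: emb.eval_poly_smult eval.hom_mult eval_f_conjugate[OF c_fixed])
    then show "c \<in> conjugate_shifts D \<union> conjugate_shifts H"
      using c_fixed by (simp add: conjugate_shifts_def)
  qed
  then have "2 ^ m \<le> card (conjugate_shifts D \<union> conjugate_shifts H)"
    unfolding card_frob_fixed[OF m_dvd, symmetric] by (intro card_mono) auto
  also have "\<dots> \<le> card (conjugate_shifts D) + degree H"
    using card_Un_le[of "conjugate_shifts D" "conjugate_shifts H"]
      card_conjugate_shifts_le[OF \<open>H \<noteq> 0\<close>] by linarith
  finally show ?thesis using degree_sum by simp
qed

lemma conjugate_shifts_add:
  assumes "minimal_annihilator D" "s \<in> conjugate_shifts D" "t \<in> conjugate_shifts D"
  shows "s + t \<in> conjugate_shifts D"
proof -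
  have eval_shift: "eval_poly emb (pcompose D [:[:s:], 1:]) y = eval_poly emb D (emb [:s:] + y)" for y
    by (simp add: emb.eval_poly_pcompose) (simp add: eval_poly_def emb.map_poly_pCons_hom)
  have "eval_poly emb (pcompose D [:[:s:], 1:] - D) eta = 0"
    using assms(1,2)
    by (simp add: eval.hom_minus eval_shift minimal_annihilator_def conjugate_shifts_def add.commute)
  then have "pcompose D [:[:s:], 1:] - D = 0"
    by (rule minimal_annihilator_eq_0[OF assms(1)]) (rule degree_pcompose_linear_diff)
  then have "eval_poly emb D (emb [:s:] + (eta + emb [:t:])) = eval_poly emb D (eta + emb [:t:])"
    using eval_shift[of "eta + emb [:t:]"] by simp
  then show ?thesis
    using assms(2,3) by (simp add: conjugate_shifts_def frob_fixed_add_K const.hom_add add_ac)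
qed

text \<open>
  A trace that is constant on the conjugates of \<open>eta\<close> annihilated by \<open>G\<close> is a fraction of polynomials:
  its remainder modulo \<open>G\<close> takes the same value at all of them.
\<close>

lemma trace_in_base:
  assumes degree_G: "degree G > 0" "degree G \<le> card (conjugate_shifts G)"
    and trace_eq_0: "\<And>s. s \<in> conjugate_shifts G \<Longrightarrow> abs_trace m (s * c) = 0"
  shows "\<exists>A B. A \<noteq> 0 \<and> emb A * abs_trace m (emb [:c:] * eta) = emb B"
proof -
  define t where "t = abs_trace m (emb [:c:] * eta)"
  define L where "L = abs_trace m ([:[:c:]:] * [:0, 1:])"
  have eval_L: "eval_poly emb L (eta + emb [:s:]) = t" if "s \<in> conjugate_shifts G" for s
  proof -
    have "eval_poly emb L (eta + emb [:s:]) = abs_trace m (emb [:c:] * (eta + emb [:s:]))"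
      unfolding L_def eval.hom_abs_trace
      by (simp only: eval.hom_mult emb.eval_poly_const emb.eval_poly_X)
    also have "\<dots> = t + abs_trace m (emb [:s * c:])"
      by (simp add: t_def distrib_left abs_trace_add[OF CHAR_d] const.hom_mult mult.commute)
    finally show ?thesis using trace_eq_0[OF that] by (simp flip: const.hom_abs_trace)
  qed
  have "G \<noteq> 0" using degree_G(1) by auto
  then obtain A H R where division: "A \<noteq> 0" "smult A L = G * H + R" "R = 0 \<or> degree R < degree G"
    using pseudo_mod[of G L] by blast
  have "map_poly emb R = [:emb A * t:]"
  proof (rule poly_eqI_degree)
    fix y assume "y \<in> (\<lambda>s. eta + emb [:s:]) ` conjugate_shifts G"
    then obtain s where y_eq: "y = eta + emb [:s:]" "s \<in> conjugate_shifts G" by auto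
    then have "emb A * t = eval_poly emb R y"
      using arg_cong[OF division(2), of "\<lambda>G. eval_poly emb G y"]
      by (simp add: emb.eval_poly_smult eval.hom_add eval.hom_mult eval_L)
        (simp add: conjugate_shifts_def)
    then show "poly (map_poly emb R) y = poly [:emb A * t:] y" by (simp add: eval_poly_def)
  next
    have "card ((\<lambda>s. eta + emb [:s:]) ` conjugate_shifts G) = card (conjugate_shifts G)"
      by (intro card_image) (simp add: inj_on_def)
    then show "degree (map_poly emb R) < card ((\<lambda>s. eta + emb [:s:]) ` conjugate_shifts G)"
      "degree [:emb A * t:] < card ((\<lambda>s. eta + emb [:s:]) ` conjugate_shifts G)"
      using division(3) degree_G by auto
  qed
  then have "coeff (map_poly emb R) 0 = emb A * t" by simp
  then have "emb A * t = emb (coeff R 0)" by (simp add: coeff_map_poly)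
  then show ?thesis using division(1) unfolding t_def by blast
qed

lemma trace_not_in_base:
  assumes "c \<in> frob_fixed m" "c \<noteq> 0" "A \<noteq> 0"
  shows "emb A * abs_trace m (emb [:c:] * eta) \<noteq> emb B"
proof
  define t where "t = abs_trace m (emb [:c:] * eta)"
  assume "emb A * abs_trace m (emb [:c:] * eta) = emb B"
  then have t_fraction: "emb A * t = emb B" by (simp add: t_def)
  have "t\<^sup>2 + t = artin_schreier m (emb [:c:] * eta)"
    unfolding t_def by (simp add: abs_trace_square_add[OF CHAR_d] artin_schreier_def)
  also have "\<dots> = emb (smult c u)"
    by (simp add: artin_schreier_scale[OF emb_const_frob_fixed[OF assms(1)]] eta flip: emb.hom_mult)
  finally have t_quadratic: "t\<^sup>2 + t = emb (smult c u)" .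
  have "emb (B\<^sup>2 + A * B) = (emb A)\<^sup>2 * (t\<^sup>2 + t)"
    by (simp add: hom_distribs t_fraction[symmetric] power2_eq_square algebra_simps)
  then have "emb (B\<^sup>2 + A * B) = emb (A\<^sup>2 * smult c u)" by (simp only: t_quadratic hom_distribs)
  then have "A dvd B" using dvd_if_square_add_mult[OF CHAR_K \<open>A \<noteq> 0\<close>, of B "smult c u"] by simp
  then obtain Q where "B = A * Q" ..
  then have "t = emb Q" using t_fraction \<open>A \<noteq> 0\<close> by (simp add: hom_distribs)
  then have "emb (artin_schreier 1 Q) = emb (smult c u)"
    using t_quadratic by (simp add: artin_schreier_def hom_distribs)
  then show False using no_quadratic_root[OF assms(2)] by simp
qed

lemma annihilator_degree:
  assumes "eval_poly emb G eta = 0" "G \<noteq> 0"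
  shows "degree G \<ge> 2 ^ m"
proof (rule ccontr)
  assume "\<not> degree G \<ge> 2 ^ m"
  obtain D where minimal: "minimal_annihilator D" using ex_minimal_annihilator[OF assms] by blast
  then have "D \<noteq> 0" "degree D \<le> degree G" "0 \<in> conjugate_shifts D"
    using assms by (auto simp: minimal_annihilator_def conjugate_shifts_def frob_fixed_0)
  then have "card (conjugate_shifts D) < 2 ^ m"
    using card_conjugate_shifts_le[of D] \<open>\<not> degree G \<ge> 2 ^ m\<close> by linarith
  then obtain c where "c \<in> frob_fixed m" "c \<noteq> 0"
    "\<And>s. s \<in> conjugate_shifts D \<Longrightarrow> abs_trace m (s * c) = 0"
    using ex_trace_annihilator[OF m_dvd, of "conjugate_shifts D"] conjugate_shifts_add[OF minimal]
      \<open>0 \<in> conjugate_shifts D\<close> by (auto simp: conjugate_shifts_def)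
  then show False
    using trace_in_base[OF minimal_annihilator_degree_pos degree_le_card_conjugate_shifts] minimal
      trace_not_in_base by blast
qed

lemma eval_eta_eq_0_iff: "eval_poly emb G eta = 0 \<longleftrightarrow> f dvd G"
proof
  assume annihilates: "eval_poly emb G eta = 0"
  obtain H R where division: "pseudo_divmod G f = (H, R)" by fastforce
  have G_eq: "G = f * H + R" and degree_R: "R = 0 \<or> degree R < 2 ^ m"
    using pseudo_divmod[OF f_nonzero division] degree_artin_schreier_poly[OF m_pos, of u]
    by simp_all
  have "eval_poly emb R eta = 0" using annihilates by (simp add: G_eq hom_distribs eval_f_eta)
  then have "R = 0" using annihilator_degree[of R] degree_R by (meson not_le)
  then show "f dvd G" using G_eq by simp
next
  assume "f dvd G"
  then show "eval_poly emb G eta = 0" by (auto simp: eval.hom_mult eval_f_eta)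
qed

end

section \<open>Places of a plane curve given by power series\<close>

definition poly2 :: "'a::comm_semiring_0 poly poly \<Rightarrow> 'a \<times> 'a \<Rightarrow> 'a" where
  "poly2 G p = poly (poly G [:snd p:]) (fst p)"

definition place_at ::
  "'k::field poly poly \<Rightarrow> 'k \<times> 'k \<Rightarrow> ('k poly poly \<times> 'k poly poly) set set \<Rightarrow> bool" where
  "place_at f p V \<longleftrightarrow> rational_point (function_field f) (const_fun f) V \<and>
     (\<forall>G. fraction f G 1 \<in> V \<and>
        value_at (function_field f) (const_fun f) V (fraction f G 1) = poly2 G p)"

locale prime_plane_curve =
  fixes f :: "'k::field poly poly"
  assumes prime_elem_f: "prime_elem f"
begin

abbreviation FF :: "('k poly poly \<times> 'k poly poly) set ring" where
  "FF \<equiv> function_field f"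

sublocale FF: field FF
  by (rule field_function_field[OF prime_elem_f])

lemma not_dvd_1: "\<not> f dvd 1"
  using prime_elem_f by (simp add: prime_elem_def)

lemma dvd_mult_iff: "f dvd g * h \<longleftrightarrow> f dvd g \<or> f dvd h"
  by (rule prime_elem_dvd_mult_iff[OF prime_elem_f])

lemmas fraction_mult = function_field_mult[OF prime_elem_f]
  and fraction_add = function_field_add[OF prime_elem_f]

lemma one_FF: "\<one>\<^bsub>FF\<^esub> = fraction f 1 1"
  and zero_FF: "\<zero>\<^bsub>FF\<^esub> = fraction f 0 1"
  by (simp_all add: function_field_def)

lemma fraction_carrier: "\<not> f dvd h \<Longrightarrow> fraction f g h \<in> carrier FF"
  by (auto simp: function_field_def)

lemma carrier_FF_cases:
  assumes "x \<in> carrier FF"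
  obtains g h where "x = fraction f g h" "\<not> f dvd h"
  using assms by (auto simp: function_field_def)

lemma fraction_eq_0_iff: "\<not> f dvd h \<Longrightarrow> fraction f g h = \<zero>\<^bsub>FF\<^esub> \<longleftrightarrow> f dvd g"
  by (simp add: zero_FF fraction_eq_iff[OF prime_elem_f] not_dvd_1)

lemma inv_fraction:
  assumes "\<not> f dvd g" "\<not> f dvd h"
  shows "inv\<^bsub>FF\<^esub> (fraction f g h) = fraction f h g"
  by (rule FF.comm_inv_char)
    (use assms in \<open>simp_all add: fraction_carrier fraction_mult one_FF
      fraction_eq_iff[OF prime_elem_f] not_dvd_1 dvd_mult_iff mult.commute\<close>)

lemma minus_fraction:
  assumes "\<not> f dvd h"
  shows "\<ominus>\<^bsub>FF\<^esub> (fraction f g h) = fraction f (- g) h"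
  by (rule FF.minus_equality)
    (use assms in \<open>simp_all add: fraction_carrier fraction_add fraction_eq_0_iff dvd_mult_iff\<close>)

lemma fraction_minus_const:
  assumes "\<not> f dvd h"
  shows "fraction f g h \<ominus>\<^bsub>FF\<^esub> const_fun f c = fraction f (g - [:[:c:]:] * h) h"
  by (simp only: a_minus_def const_fun_def minus_fraction[OF not_dvd_1] fraction_add[OF assms not_dvd_1]
      mult_1_right mult_minus_left diff_conv_add_uminus)

end

text \<open>
  A branch of the curve \<open>f = 0\<close> with a power series parametrization: substitution of the parametrization
  in a polynomial has kernel generated by \<open>f\<close>.
\<close>

locale formal_branch = germ: comm_ring_hom germ
  for germ :: "'k::field poly poly \<Rightarrow> 'k fps" +
  fixes f :: "'k poly poly"
  assumes f_nonzero: "f \<noteq> 0"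
    and germ_eq_0_iff: "germ G = 0 \<longleftrightarrow> f dvd G"
    and germ_const: "germ [:[:c:]:] = fps_const c"
    and ex_vanishing: "\<exists>G. germ G \<noteq> 0 \<and> germ G $ 0 = 0"
begin

sublocale prime_plane_curve f
proof
  have "\<not> f dvd 1" by (simp flip: germ_eq_0_iff)
  then show "prime_elem f"
    using f_nonzero by (auto simp: prime_elem_def germ.hom_mult simp flip: germ_eq_0_iff)
qed

definition local_ring :: "('k poly poly \<times> 'k poly poly) set set" where
  "local_ring = {fraction f g h | g h. \<not> f dvd h \<and> germ h dvd germ g}"

lemma local_ring_cases:
  assumes "x \<in> local_ring"
  obtains g h where "x = fraction f g h" "\<not> f dvd h" "germ h dvd germ g"
  using assms by (auto simp: local_ring_def)

lemma fraction_in_local_ring_iff: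
  assumes h_not_dvd: "\<not> f dvd h"
  shows "fraction f g h \<in> local_ring \<longleftrightarrow> germ h dvd germ g"
proof
  assume "fraction f g h \<in> local_ring"
  then obtain g' h' where fractions_eq: "fraction f g h = fraction f g' h'"
    and h'_not_dvd: "\<not> f dvd h'" and "germ h' dvd germ g'"
    by (rule local_ring_cases)
  have "f dvd g * h' - g' * h"
    using fractions_eq h_not_dvd h'_not_dvd by (simp add: fraction_eq_iff[OF prime_elem_f])
  then have cross_mult: "germ g * germ h' = germ g' * germ h"
    by (simp add: germ.hom_minus germ.hom_mult flip: germ_eq_0_iff)
  obtain k where "germ g' = germ h' * k" using \<open>germ h' dvd germ g'\<close> ..
  then have "germ h' * germ g = germ h' * (germ h * k)" using cross_mult by (simp add: mult_ac)
  then show "germ h dvd germ g" using h'_not_dvd by (simp add: germ_eq_0_iff)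
qed (use h_not_dvd in \<open>auto simp: local_ring_def\<close>)

lemma polynomial_in_local_ring: "fraction f G 1 \<in> local_ring"
  by (simp add: fraction_in_local_ring_iff[OF not_dvd_1])

lemma fraction_in_maximal_ideal_iff:
  assumes h_not_dvd: "\<not> f dvd h"
  shows "fraction f g h \<in> maximal_ideal_of FF local_ring \<longleftrightarrow> (\<exists>s. germ g = germ h * s \<and> s $ 0 = 0)"
proof (cases "f dvd g")
  case True
  then have "germ g = 0" by (simp add: germ_eq_0_iff)
  then show ?thesis using True h_not_dvd
    by (auto simp: maximal_ideal_of_def fraction_in_local_ring_iff fraction_eq_0_iff intro: exI[of _ 0])
next
  case False
  then have nonzero: "germ g \<noteq> 0" "germ h \<noteq> 0" using h_not_dvd by (auto simp: germ_eq_0_iff)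
  have "fraction f g h \<in> maximal_ideal_of FF local_ring \<longleftrightarrow> germ h dvd germ g \<and> \<not> germ g dvd germ h"
    using False h_not_dvd
    by (simp add: maximal_ideal_of_def fraction_in_local_ring_iff fraction_eq_0_iff inv_fraction)
  also have "\<dots> \<longleftrightarrow> (\<exists>s. germ g = germ h * s \<and> \<not> s dvd 1)"
  proof -
    have "germ h * s dvd germ h \<longleftrightarrow> s dvd 1" for s
      using dvd_mult_cancel_left[of "germ h" s 1] nonzero(2) by simp
    then show ?thesis unfolding dvd_def[of "germ h" "germ g"] by (metis (lifting))
  qed
  finally show ?thesis by simp
qed

lemma fraction_minus_const_in_maximal_ideal_iff:
  assumes h_not_dvd: "\<not> f dvd h" and germ_g: "germ g = germ h * s"
  shows "fraction f g h \<ominus>\<^bsub>FF\<^esub> const_fun f c \<in> maximal_ideal_of FF local_ring \<longleftrightarrow> c = s $ 0"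
proof -
  have "germ h \<noteq> 0" using h_not_dvd by (simp add: germ_eq_0_iff)
  have "germ (g - [:[:c:]:] * h) = germ h * (s - fps_const c)"
    by (simp only: germ.hom_minus germ.hom_mult germ_const germ_g right_diff_distrib mult.commute)
  then have "fraction f g h \<ominus>\<^bsub>FF\<^esub> const_fun f c \<in> maximal_ideal_of FF local_ring
      \<longleftrightarrow> (\<exists>r. germ h * (s - fps_const c) = germ h * r \<and> r $ 0 = 0)"
    by (simp only: fraction_minus_const[OF h_not_dvd] fraction_in_maximal_ideal_iff[OF h_not_dvd])
  also have "\<dots> \<longleftrightarrow> (s - fps_const c) $ 0 = 0" using \<open>germ h \<noteq> 0\<close> by auto
  finally show ?thesis by auto
qed

lemma value_at_polynomial: "value_at FF (const_fun f) local_ring (fraction f G 1) = germ G $ 0"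
  using fraction_minus_const_in_maximal_ideal_iff[OF not_dvd_1, of G "germ G"]
  by (simp add: value_at_def)

lemma local_ring_subset: "local_ring \<subseteq> carrier FF"
  by (auto simp: local_ring_def fraction_carrier)

lemma subring_local_ring: "subring local_ring FF"
proof (rule FF.subringI)
  show "local_ring \<subseteq> carrier FF" by (rule local_ring_subset)
  show "\<one>\<^bsub>FF\<^esub> \<in> local_ring" by (simp add: one_FF polynomial_in_local_ring)
next
  fix x assume "x \<in> local_ring"
  then show "\<ominus>\<^bsub>FF\<^esub> x \<in> local_ring"
    by (rule local_ring_cases) (simp add: minus_fraction fraction_in_local_ring_iff germ.hom_uminus)
next
  fix x y assume "x \<in> local_ring" "y \<in> local_ring"
  then obtain g h e k where x_fraction: "x = fraction f g h" "\<not> f dvd h" "germ h dvd germ g"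
    and y_fraction: "y = fraction f e k" "\<not> f dvd k" "germ k dvd germ e"
    by (metis local_ring_cases)
  then have hk_not_dvd: "\<not> f dvd h * k" by (simp add: dvd_mult_iff)
  show "x \<otimes>\<^bsub>FF\<^esub> y \<in> local_ring"
    using x_fraction y_fraction
    by (simp add: fraction_mult fraction_in_local_ring_iff[OF hk_not_dvd] germ.hom_mult mult_dvd_mono)
  show "x \<oplus>\<^bsub>FF\<^esub> y \<in> local_ring"
    using x_fraction y_fraction
    by (simp add: fraction_add fraction_in_local_ring_iff[OF hk_not_dvd] germ.hom_mult germ.hom_add)
qed

lemma valuation_ring_local_ring: "valuation_ring FF (const_fun f) local_ring"
proof -
  obtain G where "germ G \<noteq> 0" and vanishing: "germ G $ 0 = 0" using ex_vanishing by blast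
  then have G_not_dvd: "\<not> f dvd G" by (simp add: germ_eq_0_iff)
  have "fraction f G 1 \<notin> range (const_fun f)"
  proof
    assume "fraction f G 1 \<in> range (const_fun f)"
    then obtain c where "f dvd G - [:[:c:]:]"
      by (auto simp: const_fun_def fraction_eq_iff[OF prime_elem_f] not_dvd_1)
    then have "germ G = fps_const c" by (simp add: germ.hom_minus germ_const flip: germ_eq_0_iff)
    then show False using \<open>germ G \<noteq> 0\<close> vanishing by simp
  qed
  then have "range (const_fun f) \<subset> local_ring"
    using polynomial_in_local_ring by (auto simp: const_fun_def psubset_eq)
  moreover have "fraction f 1 G \<notin> local_ring"
    using vanishing by (simp add: fraction_in_local_ring_iff[OF G_not_dvd])
  then have "local_ring \<subset> carrier FF"
    using local_ring_subset fraction_carrier[OF G_not_dvd] by blast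
  moreover have "z \<in> local_ring \<or> inv\<^bsub>FF\<^esub> z \<in> local_ring" if z_nonzero: "z \<in> carrier FF - {\<zero>\<^bsub>FF\<^esub>}" for z
  proof -
    have "z \<in> carrier FF" using z_nonzero by simp
    then obtain g h where z_fraction: "z = fraction f g h" "\<not> f dvd h" by (rule carrier_FF_cases)
    then have "\<not> f dvd g" using z_nonzero by (simp add: fraction_eq_0_iff)
    then have "germ g \<noteq> 0" "germ h \<noteq> 0" using z_fraction by (simp_all add: germ_eq_0_iff)
    then have "germ h dvd germ g \<or> germ g dvd germ h" by (auto simp: fps_dvd_iff)
    then show ?thesis
      using z_fraction \<open>\<not> f dvd g\<close> by (simp add: inv_fraction fraction_in_local_ring_iff)
  qed
  ultimately show ?thesis unfolding valuation_ring_def using subring_local_ring by blast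
qed

lemma rational_point_local_ring: "rational_point FF (const_fun f) local_ring"
  unfolding rational_point_def
proof (intro conjI ballI)
  fix z assume "z \<in> local_ring"
  then obtain g h s where "z = fraction f g h" "\<not> f dvd h" "germ g = germ h * s"
    by (auto elim!: local_ring_cases dvdE)
  then show "\<exists>c. z \<ominus>\<^bsub>FF\<^esub> const_fun f c \<in> maximal_ideal_of FF local_ring"
    using fraction_minus_const_in_maximal_ideal_iff by blast
qed (rule valuation_ring_local_ring)

lemma place_at_local_ring:
  assumes "\<And>G. germ G $ 0 = poly2 G p"
  shows "place_at f p local_ring"
  by (simp add: place_at_def rational_point_local_ring polynomial_in_local_ring value_at_polynomial assms)

end

lemma (in artin_schreier_curve) ex_formal_branch:
  assumes "artin_schreier m y = poly u x"
  shows "\<exists>germ. formal_branch germ f \<and> (\<forall>G. germ G $ 0 = poly2 G (x, y))"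
proof -
  define emb where "emb p = fps_of_poly (pcompose p [:x, 1:])" for p :: "'k poly"
  have emb_0: "emb p $ 0 = poly p x" for p by (simp add: emb_def pcompose_coeff_0)
  interpret emb: inj_comm_ring_hom emb
  proof unfold_locales
    show "p = 0" if "emb p = 0" for p
      using that fps_of_poly_eq_iff[of _ 0] pcompose_eq_0[of p "[:x, 1:]"] by (simp add: emb_def)
  qed (simp_all add: emb_def pcompose_add pcompose_mult pcompose_1 fps_of_poly_add fps_of_poly_mult)
  obtain eta where root: "artin_schreier m eta = emb u" and eta_0: "eta $ 0 = y"
    using ex_fps_artin_schreier[of "2 ^ m" m y "emb u"] assms m_pos one_less_power[of "2::nat" m]
    by (auto simp: artin_schreier_def CHAR_K emb_0)
  interpret artin_schreier_extension ty n m u emb eta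
    by unfold_locales (rule root)
  interpret germ: comm_ring_hom "\<lambda>G. eval_poly emb G eta"
    by (rule emb.comm_ring_hom_eval_poly)
  have "formal_branch (\<lambda>G. eval_poly emb G eta) f"
  proof unfold_locales
    show "\<exists>G. eval_poly emb G eta \<noteq> 0 \<and> eval_poly emb G eta $ 0 = 0"
      by (intro exI[of _ "[:[:- x, 1:]:]"]) (simp add: emb.eval_poly_const emb_0)
  qed (simp_all add: f_nonzero eval_eta_eq_0_iff emb.eval_poly_const, simp add: emb_def fps_of_poly_const)
  moreover have "eval_poly emb G eta $ 0 = poly2 G (x, y)" for G
    by (induction G)
      (simp_all add: poly2_def eval_poly_def emb.map_poly_pCons_hom emb_0 eta_0 mult.commute)
  ultimately show ?thesis by blast
qed

lemma (in artin_schreier_curve)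
  assumes "artin_schreier m y = poly u x"
  shows ex_place: "\<exists>V. place_at f (x, y) V"
    and prime_plane_curve: "prime_plane_curve f"
proof -
  obtain germ where "formal_branch germ f" and germ_0: "\<And>G. germ G $ 0 = poly2 G (x, y)"
    using ex_formal_branch[OF assms] by blast
  then interpret formal_branch germ f by simp
  show "\<exists>V. place_at f (x, y) V" using place_at_local_ring[OF germ_0] by blast
  show "prime_plane_curve f" by unfold_locales
qed

section \<open>Evaluation codes of bivariate polynomials\<close>

global_interpretation bipoly: vector_space "\<lambda>c::'k::field. smult [:c:] :: 'k poly poly \<Rightarrow> 'k poly poly"
  by unfold_locales
    (simp_all add: smult_add_right smult_add_left[symmetric] mult.commute one_pCons[symmetric])

definition plane_word :: "nat \<Rightarrow> (nat \<Rightarrow> 'k \<times> 'k) \<Rightarrow> 'k::field poly poly \<Rightarrow> nat \<Rightarrow> 'k" where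
  "plane_word n pt G k = (if k < n then poly2 G (pt k) else 0)"

definition plane_code :: "nat \<Rightarrow> (nat \<Rightarrow> 'k \<times> 'k) \<Rightarrow> 'k::field poly poly set \<Rightarrow> (nat \<Rightarrow> 'k) set" where
  "plane_code n pt L = plane_word n pt ` L"

lemma poly2_add: "poly2 (G + H) p = poly2 G p + poly2 H p"
  by (simp add: poly2_def)

lemma poly2_smult: "poly2 (smult [:c:] G) p = c * poly2 G p"
  by (simp add: poly2_def)

lemma linear_plane_word: "Vector_Spaces.linear (\<lambda>c. smult [:c:]) scale_word (plane_word n pt)"
  by unfold_locales (auto simp: plane_word_def scale_word_def poly2_add poly2_smult)

lemma linear_code_plane_code:
  assumes "bipoly.subspace L"
  shows "linear_code n (plane_code n pt L)"
proof -
  interpret plane_word: Vector_Spaces.linear "\<lambda>c. smult [:c:]" scale_word "plane_word n pt"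
    by (rule linear_plane_word)
  show ?thesis
    using plane_word.subspace_image[OF assms]
    by (auto simp: linear_code_def plane_code_def plane_word_def)
qed

lemma recovery_set_if_subspace:
  assumes "word.subspace C" and zero: "\<And>w. w \<in> C \<Longrightarrow> (\<And>k. k \<in> A \<Longrightarrow> w k = 0) \<Longrightarrow> w i = 0"
  shows "recovery_set C i A"
proof -
  have agree: "w i = v i" if "w \<in> C" "v \<in> C" "restrict w A = restrict v A" for v w
  proof -
    have difference: "(w - v) k = 0" if "k \<in> A" for k
      using that fun_cong[OF \<open>restrict w A = restrict v A\<close>, of k] by simp
    have "w - v \<in> C" by (rule word.subspace_diff[OF assms(1) that(1,2)])
    then have "(w - v) i = 0" by (rule zero) (rule difference)
    then show ?thesis by simp
  qed
  define representative where "representative r = (SOME v. v \<in> C \<and> restrict v A = r)" for r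
  have "w i = representative (restrict w A) i" if "w \<in> C" for w
  proof (rule agree[OF that])
    have "representative (restrict w A) \<in> C \<and> restrict (representative (restrict w A)) A = restrict w A"
      unfolding representative_def by (rule someI[of _ w]) (simp add: that)
    then show "representative (restrict w A) \<in> C" "restrict w A = restrict (representative (restrict w A)) A"
      by simp_all
  qed
  then show ?thesis unfolding recovery_set_def by (intro exI[of _ "\<lambda>r. representative r i"]) blast
qed

definition determines :: "'k::field poly poly set \<Rightarrow> ('k \<times> 'k) set \<Rightarrow> 'k \<times> 'k \<Rightarrow> bool" where
  "determines L B p \<longleftrightarrow> (\<forall>G\<in>L. (\<forall>b\<in>B. poly2 G b = 0) \<longrightarrow> poly2 G p = 0)"

lemma availability2_locality_plane_code:
  assumes pt_bij: "bij_betw pt {..<n} P" and L_subspace: "bipoly.subspace L"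
    and recover: "\<And>p. p \<in> P \<Longrightarrow> \<exists>B1 B2. B1 \<subseteq> P - {p} \<and> B2 \<subseteq> P - {p} \<and> B1 \<inter> B2 = {} \<and>
      card B1 = r1 \<and> card B2 = r2 \<and> determines L B1 p \<and> determines L B2 p"
  shows "availability2_locality n (plane_code n pt L) r1 r2"
  unfolding availability2_locality_def
proof (intro allI impI)
  fix k assume "k < n"
  then have "pt k \<in> P" using pt_bij by (auto simp: bij_betw_def)
  then obtain B1 B2 where recovering: "B1 \<subseteq> P - {pt k}" "B2 \<subseteq> P - {pt k}" "B1 \<inter> B2 = {}"
    "card B1 = r1" "card B2 = r2" "determines L B1 (pt k)" "determines L B2 (pt k)"
    using recover by blast
  define positions where "positions B = {l. l < n \<and> pt l \<in> B}" for B
  have card_positions: "card (positions B) = card B" if "B \<subseteq> P" for B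
  proof -
    have "bij_betw pt (positions B) B"
      using pt_bij that by (auto simp: bij_betw_def positions_def inj_on_def)
    then show ?thesis by (rule bij_betw_same_card)
  qed
  have recovery: "recovery_set (plane_code n pt L) k (positions B)"
    if "B \<subseteq> P" "determines L B (pt k)" for B
  proof (rule recovery_set_if_subspace)
    show "word.subspace (plane_code n pt L)"
      using linear_code_plane_code[OF L_subspace] by (simp add: linear_code_def)
    fix w assume "w \<in> plane_code n pt L" and zero: "\<And>l. l \<in> positions B \<Longrightarrow> w l = 0"
    then obtain G where G_word: "G \<in> L" "w = plane_word n pt G" by (auto simp: plane_code_def)
    have "poly2 G b = 0" if "b \<in> B" for b
    proof -
      have "b \<in> pt ` {..<n}" using pt_bij that \<open>B \<subseteq> P\<close> by (auto simp: bij_betw_def)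
      then obtain l where "l < n" "pt l = b" by auto
      then show ?thesis using zero[of l] that G_word(2) by (simp add: positions_def plane_word_def)
    qed
    then show "w k = 0"
      using that(2) G_word \<open>k < n\<close> by (auto simp: determines_def plane_word_def)
  qed
  show "\<exists>A1 A2. A1 \<subseteq> {..<n} - {k} \<and> A2 \<subseteq> {..<n} - {k} \<and> A1 \<inter> A2 = {} \<and> card A1 = r1 \<and> card A2 = r2 \<and>
      recovery_set (plane_code n pt L) k A1 \<and> recovery_set (plane_code n pt L) k A2"
    using recovering card_positions[of B1] card_positions[of B2] recovery[of B1] recovery[of B2]
    by (intro exI[of _ "positions B1"] exI[of _ "positions B2"]) (auto simp: positions_def)
qed

definition monomial :: "nat \<times> nat \<Rightarrow> 'k::field poly poly" where
  "monomial e = monom (monom 1 (fst e)) (snd e)"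

definition monomial_space :: "(nat \<times> nat) set \<Rightarrow> 'k::field poly poly set" where
  "monomial_space E = {G. \<forall>i j. coeff (coeff G j) i \<noteq> 0 \<longrightarrow> (i, j) \<in> E}"

lemma poly2_monomial: "poly2 (monomial e) p = fst p ^ fst e * snd p ^ snd e"
  by (simp add: poly2_def monomial_def poly_monom poly_const_pow)

lemma coeff_sum_monomial:
  assumes "finite E"
  shows "coeff (coeff (\<Sum>e\<in>E. smult [:c e:] (monomial e)) j) i = (if (i, j) \<in> E then c (i, j) else 0)"
proof -
  have "coeff (coeff (\<Sum>e\<in>E. smult [:c e:] (monomial e)) j) i
      = (\<Sum>e\<in>E. if e = (i, j) then c e else 0)"
    unfolding coeff_sum by (intro sum.cong refl) (auto simp: monomial_def)
  then show ?thesis using assms by (simp add: sum.delta)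
qed

lemma subspace_monomial_space: "bipoly.subspace (monomial_space E)"
  by (rule bipoly.subspaceI) (auto simp: monomial_space_def, metis add_0)

lemma span_monomials:
  assumes "finite E"
  shows "bipoly.span (monomial ` E) = (monomial_space E :: 'k::field poly poly set)"
    (is "?span = ?space")
proof
  show "?span \<subseteq> ?space"
    by (rule bipoly.span_minimal[OF _ subspace_monomial_space])
      (auto simp: monomial_space_def monomial_def split: if_splits)
  show "?space \<subseteq> ?span"
  proof
    fix G assume "G \<in> ?space"
    then have "(\<Sum>e\<in>E. smult [:coeff (coeff G (snd e)) (fst e):] (monomial e)) = G"
      by (intro poly_eqI) (auto simp: coeff_sum_monomial[OF assms] monomial_space_def)
    moreover have "(\<Sum>e\<in>E. smult [:coeff (coeff G (snd e)) (fst e):] (monomial e)) \<in> ?span"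
      by (intro bipoly.span_sum bipoly.span_scale bipoly.span_base imageI)
    ultimately show "G \<in> ?span" by simp
  qed
qed

lemma inj_monomial: "inj (monomial :: _ \<Rightarrow> 'k::field poly poly)"
proof (rule injI)
  fix d e assume "monomial d = (monomial e :: 'k poly poly)"
  then have "coeff (coeff (monomial d :: 'k poly poly) (snd d)) (fst d)
      = coeff (coeff (monomial e) (snd d)) (fst d)" by simp
  then show "d = e" by (auto simp: monomial_def prod_eq_iff split: if_splits)
qed

lemma independent_monomials:
  assumes "finite E"
  shows "bipoly.independent (monomial ` E :: 'k::field poly poly set)"
  unfolding bipoly.dependent_finite[OF finite_imageI[OF assms]]
proof (intro notI, elim exE conjE bexE)
  fix u and v :: "'k poly poly"
  assume "v \<in> monomial ` E" "u v \<noteq> 0" and "(\<Sum>v\<in>monomial ` E. smult [:u v:] v) = 0"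
  then obtain i j where v_eq: "(i, j) \<in> E" "v = monomial (i, j)"
    and "(\<Sum>e\<in>E. smult [:u (monomial e):] (monomial e)) = 0"
    using sum.reindex[OF inj_on_subset[OF inj_monomial], of E "\<lambda>v. smult [:u v:] v"] by auto
  then show False
    using coeff_sum_monomial[OF assms, of "\<lambda>e. u (monomial e)" j i] \<open>u v \<noteq> 0\<close> by simp
qed

lemma dim_plane_code_monomial_space:
  fixes pt :: "nat \<Rightarrow> 'k::field \<times> 'k"
  assumes "finite E"
    and injective: "\<And>G. G \<in> monomial_space E \<Longrightarrow> (\<And>k. k < n \<Longrightarrow> poly2 G (pt k) = 0) \<Longrightarrow> G = 0"
  shows "word.dim (plane_code n pt (monomial_space E)) = card E"
proof -
  interpret plane_word: Vector_Spaces.linear "\<lambda>c. smult [:c:]" scale_word "plane_word n pt"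
    by (rule linear_plane_word)
  have "inj_on (plane_word n pt) (monomial_space E)"
    unfolding plane_word.inj_on_iff_eq_0[OF subspace_monomial_space]
    using injective by (metis plane_word_def zero_fun_apply)
  then have inj_span: "inj_on (plane_word n pt) (bipoly.span (monomial ` E))"
    by (simp only: span_monomials[OF assms(1)])
  have "plane_code n pt (monomial_space E) = word.span (plane_word n pt ` monomial ` E)"
    unfolding plane_code_def span_monomials[OF assms(1), symmetric]
    by (rule plane_word.span_image[symmetric])
  moreover have "word.independent (plane_word n pt ` monomial ` E)"
    by (rule plane_word.independent_injective_image[OF independent_monomials[OF assms(1)] inj_span])
  ultimately have "word.dim (plane_code n pt (monomial_space E)) = card (plane_word n pt ` monomial ` E)"
    by (simp add: word.dim_eq_card_independent)
  also have "\<dots> = card (monomial ` E :: 'k poly poly set)"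
    using inj_on_subset[OF inj_span bipoly.span_superset] by (rule card_image)
  also have "\<dots> = card E" using inj_monomial by (intro card_image) (rule inj_on_subset, auto)
  finally show ?thesis .
qed

lemma poly_eq_0_if_vanishing:
  fixes p :: "'a::idom poly"
  assumes "\<And>j. j \<ge> l \<Longrightarrow> coeff p j = 0" "l \<le> card A" "\<And>x. x \<in> A \<Longrightarrow> poly p x = 0"
  shows "p = 0"
proof (rule ccontr)
  assume "p \<noteq> 0"
  then have "degree p < l" using assms(1) by (intro degree_lessI) auto
  then show False using poly_eqI_degree[of A p 0] assms(2,3) \<open>p \<noteq> 0\<close> by simp
qed

lemma coeffs_vanish_if_vanishing_on_fibre:
  fixes G :: "'a::idom poly poly"
  assumes "\<And>j. j \<ge> l \<Longrightarrow> coeff G j = 0" "l \<le> card Y" "\<And>y. y \<in> Y \<Longrightarrow> poly2 G (x, y) = 0"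
  shows "poly (coeff G j) x = 0"
proof -
  have restrict: "poly2 G (x, y) = poly (map_poly (\<lambda>p. poly p x) G) y" for y
    by (induction G) (simp_all add: poly2_def map_poly_pCons mult.commute)
  have "map_poly (\<lambda>p. poly p x) G = 0"
    by (rule poly_eq_0_if_vanishing[of l _ Y]) (use assms restrict in \<open>simp_all add: coeff_map_poly\<close>)
  then show ?thesis using coeff_map_poly[of "\<lambda>p. poly p x" G j] by simp
qed

lemma poly2_eq_0_if_vanishing_on_fibre:
  fixes G :: "'a::idom poly poly"
  assumes "\<And>j. j \<ge> l \<Longrightarrow> coeff G j = 0" "l \<le> card Y" "\<And>y. y \<in> Y \<Longrightarrow> poly2 G (x, y) = 0"
  shows "poly2 G (x, z) = 0"
proof -
  have "poly2 G (x, z) = (\<Sum>j\<le>degree G. poly (coeff G j) x * z ^ j)"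
    by (simp add: poly2_def poly_altdef[of G] poly_sum poly_const_pow mult.commute)
  then show ?thesis using coeffs_vanish_if_vanishing_on_fibre[OF assms] by simp
qed

lemma eq_0_if_vanishing_on_fibres:
  fixes G :: "'a::field poly poly"
  assumes "G \<in> monomial_space ({..<k} \<times> {..<l})" "k \<le> card X" "\<And>x. x \<in> X \<Longrightarrow> l \<le> card (Y x)"
    and "\<And>x y. x \<in> X \<Longrightarrow> y \<in> Y x \<Longrightarrow> poly2 G (x, y) = 0"
  shows "G = 0"
proof (rule poly_eqI)
  fix j
  have coeff_G: "coeff (coeff G j) i = 0" if "i \<ge> k \<or> j \<ge> l" for i j
    using assms(1) that by (force simp: monomial_space_def)
  then have "coeff G j = 0" if "j \<ge> l" for j using that by (intro poly_eqI) simp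
  then have "poly (coeff G j) x = 0" if "x \<in> X" for x
    using that assms(3,4) by (intro coeffs_vanish_if_vanishing_on_fibre[of l G "Y x"]) auto
  then show "coeff G j = coeff 0 j"
    using poly_eq_0_if_vanishing[of k "coeff G j" X] coeff_G assms(2) by simp
qed

context prime_plane_curve
begin

lemma function_space_polynomials:
  assumes "bipoly.subspace L"
  shows "function_space FF (const_fun f) ((\<lambda>G. fraction f G 1) ` L)"
proof -
  have add: "fraction f G 1 \<oplus>\<^bsub>FF\<^esub> fraction f H 1 = fraction f (G + H) 1" for G H
    by (simp add: fraction_add not_dvd_1)
  have neg: "\<ominus>\<^bsub>FF\<^esub> fraction f G 1 = fraction f (- G) 1" for G
    by (rule minus_fraction[OF not_dvd_1])
  have scale: "const_fun f c \<otimes>\<^bsub>FF\<^esub> fraction f G 1 = fraction f (smult [:c:] G) 1" for c G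
    by (simp add: const_fun_def fraction_mult not_dvd_1)
  show ?thesis
    unfolding function_space_def
  proof (intro conjI allI ballI)
    show "subgroup ((\<lambda>G. fraction f G 1) ` L) (add_monoid FF)"
    proof (rule FF.add.subgroupI)
      show "(\<lambda>G. fraction f G 1) ` L \<subseteq> carrier FF" by (auto simp: fraction_carrier not_dvd_1)
      show "(\<lambda>G. fraction f G 1) ` L \<noteq> {}" using bipoly.subspace_0[OF assms] by auto
    qed (use assms in \<open>auto simp: add neg bipoly.subspace_add bipoly.subspace_neg\<close>)
    show "const_fun f c \<otimes>\<^bsub>FF\<^esub> z \<in> (\<lambda>G. fraction f G 1) ` L" if "z \<in> (\<lambda>G. fraction f G 1) ` L" for c z
      using that assms by (auto simp: scale bipoly.subspace_scale)
  qed
qed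

lemma is_evaluation_code_plane_code:
  assumes "inj_on pt {..<n}" and places: "\<And>k. k < n \<Longrightarrow> \<exists>V. place_at f (pt k) V"
    and "bipoly.subspace L"
  shows "is_evaluation_code FF (const_fun f) n (plane_code n pt L)"
proof -
  obtain P where "\<And>k. k < n \<Longrightarrow> place_at f (pt k) (P k)" using places by metis
  then have place: "rational_point FF (const_fun f) (P k)" "fraction f G 1 \<in> P k"
    "value_at FF (const_fun f) (P k) (fraction f G 1) = poly2 G (pt k)" if "k < n" for k G
    using that by (auto simp: place_at_def)
  have "inj_on P {..<n}"
  proof (rule inj_onI)
    fix k l assume same_place: "k \<in> {..<n}" "l \<in> {..<n}" "P k = P l"
    then have "poly2 G (pt k) = poly2 G (pt l)" for G
      using place(3)[of k G] place(3)[of l G] by simp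
    from this[of "monomial (1, 0)"] this[of "monomial (0, 1)"] have "pt k = pt l"
      by (simp add: poly2_monomial prod_eq_iff)
    then show "k = l" using assms(1) same_place(1,2) by (simp add: inj_on_eq_iff)
  qed
  moreover have "plane_code n pt L
      = evaluation_code FF (const_fun f) n P ((\<lambda>G. fraction f G 1) ` L)"
    by (auto simp: plane_code_def evaluation_code_def plane_word_def image_image place(3) fun_eq_iff
        intro!: image_cong)
  ultimately show ?thesis
    unfolding is_evaluation_code_def
    using place(1,2) function_space_polynomials[OF assms(3)]
    by (intro exI[of _ P] exI[of _ "(\<lambda>G. fraction f G 1) ` L"]) auto
qed

end

lemma card_multiples_shifted:
  assumes "M > 0"
  shows "card {i. i < M * N \<and> M dvd i + t} = (N::nat)"
proof -
  define r where "r = nat (- int t mod int M)"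
  have int_r: "- int t mod int M = int r" using assms by (simp add: r_def)
  have "r < M" using assms by (simp add: r_def nat_less_iff)
  have residue: "M dvd i + t \<longleftrightarrow> i mod M = r" for i
  proof -
    have "M dvd i + t \<longleftrightarrow> int M dvd int i - (- int t)" by (simp flip: of_nat_add of_nat_dvd_iff)
    also have "\<dots> \<longleftrightarrow> int i mod int M = - int t mod int M" by (simp only: mod_eq_dvd_iff)
    also have "\<dots> \<longleftrightarrow> i mod M = r" by (simp only: int_r zmod_int[symmetric] of_nat_eq_iff)
    finally show ?thesis .
  qed
  have "{i. i < M * N \<and> M dvd i + t} = (\<lambda>k. k * M + r) ` {..<N}"
  proof (intro equalityI subsetI)
    fix i assume "i \<in> {i. i < M * N \<and> M dvd i + t}"
    then have "i = i div M * M + r" "i div M < N"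
      using residue by (auto simp: less_mult_imp_div_less mult.commute)
    then show "i \<in> (\<lambda>k. k * M + r) ` {..<N}" by blast
  next
    fix i assume "i \<in> (\<lambda>k. k * M + r) ` {..<N}"
    then obtain k where i_eq: "i = k * M + r" "k < N" by auto
    have "k * M + r < Suc k * M" using \<open>r < M\<close> by simp
    also have "\<dots> \<le> N * M" using i_eq(2) by (intro mult_le_mono1) simp
    finally show "i \<in> {i. i < M * N \<and> M dvd i + t}"
      using i_eq \<open>r < M\<close> residue by (simp add: mult.commute)
  qed
  moreover have "inj_on (\<lambda>k. k * M + r) {..<N}" using assms by (simp add: inj_on_def)
  ultimately show ?thesis by (simp add: card_image)
qed

lemma card_exponents_not_dvd:
  assumes "M > 0"
  shows "card {(i, j). i < M * N \<and> j < l \<and> \<not> M dvd i + w * j} = l * ((M - 1) * N)"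
proof -
  define column where "column j = {..<M * N} - {i. i < M * N \<and> M dvd i + w * j}" for j
  have "card (column j) = (M - 1) * N" for j
    unfolding column_def
    by (subst card_Diff_subset) (auto simp: card_multiples_shifted[OF assms] diff_mult_distrib)
  then have "card (SIGMA j:{..<l}. column j) = l * ((M - 1) * N)"
    by (simp add: card_SigmaI column_def)
  moreover have "{(i, j). i < M * N \<and> j < l \<and> \<not> M dvd i + w * j} = prod.swap ` (SIGMA j:{..<l}. column j)"
    by (force simp: column_def)
  ultimately show ?thesis by (simp add: card_image)
qed

section \<open>Codes on the Suzuki curve\<close>

context suzuki
begin

definition rhs_poly :: "'k poly" where
  "rhs_poly = monom 1 q0 * (monom 1 q + monom 1 1)"

lemma poly_rhs_poly: "poly rhs_poly x = rhs x"
  by (simp add: rhs_poly_def rhs_def artin_schreier_eq poly_monom)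

lemma suzuki_poly_eq: "suzuki_poly q0 q = artin_schreier_poly m rhs_poly"
  by (simp only: suzuki_poly_def artin_schreier_poly_def rhs_poly_def q_def[symmetric])

lemma coeff_rhs_poly: "coeff rhs_poly (2 ^ i * (2 * q0 + 1)) = (if i = a then 1 else 0)"
proof -
  have "q0 + 1 < 1 * (2 * q0 + 1)" using q_pos by simp
  also have "\<dots> \<le> 2 ^ i * (2 * q0 + 1)" by (intro mult_le_mono1) simp
  finally have "q0 + 1 \<noteq> 2 ^ i * (2 * q0 + 1)" by simp
  moreover have "2 ^ a * (2 * q0 + 1) = q0 + q" by (simp add: q_eq algebra_simps flip: q0_def)
  then have "rhs_poly = monom 1 (2 ^ a * (2 * q0 + 1)) + monom 1 (q0 + 1)"
    by (simp only: rhs_poly_def distrib_left mult_monom mult_1_right)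
  moreover have "2 ^ a * (2 * q0 + 1) = 2 ^ i * (2 * q0 + 1) \<longleftrightarrow> i = a"
    by (simp only: mult_cancel2) auto
  ultimately show ?thesis by (simp only: coeff_add coeff_monom) simp
qed

sublocale artin_schreier_curve ty n m rhs_poly
proof
  show "artin_schreier 1 Q \<noteq> smult c rhs_poly" if "c \<noteq> 0" for c :: 'k and Q
  proof
    assume "artin_schreier 1 Q = smult c rhs_poly"
    then have "Q\<^sup>2 + Q = smult c rhs_poly" by (simp add: artin_schreier_def)
    then have "coeff (smult c rhs_poly) (2 ^ a * (2 * q0 + 1)) = 0"
      by (rule coeff_eq_0_if_square_add[OF CHAR_K]) (simp, simp only: coeff_smult coeff_rhs_poly, simp)
    then show False using that by (simp only: coeff_smult coeff_rhs_poly) simp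
  qed
qed (rule m_dvd)

definition points :: "('k \<times> 'k) set" where
  "points = (SIGMA x:abscissas. {y. artin_schreier m y = rhs x})"

definition torus :: "'k \<Rightarrow> 'k \<times> 'k \<Rightarrow> 'k \<times> 'k" where
  "torus z p = (z * fst p, z ^ (q0 + 1) * snd p)"

lemma torus_in_points:
  assumes "p \<in> points" "z \<in> frob_fixed m" "z \<noteq> 0"
  shows "torus z p \<in> points"
proof -
  have "artin_schreier m (z ^ (q0 + 1) * snd p) = rhs (z * fst p)"
    using assms(1) artin_schreier_scale[OF frob_fixed_power[OF assms(2)], of "q0 + 1" "snd p"]
      rhs_scale[OF assms(2)]
    by (auto simp: points_def)
  then show ?thesis
    using assms by (auto simp: points_def torus_def abscissas_def intro: range_eqI[OF sym])
qed

lemma torus_inj: "p \<in> points \<Longrightarrow> torus z p = torus w p \<longleftrightarrow> z = w"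
  by (auto simp: torus_def points_def abscissas_def)

lemma card_fibre:
  assumes "x \<in> abscissas"
  shows "card {y. artin_schreier m y = rhs x} = q"
proof -
  obtain y where "rhs x = artin_schreier m y" using assms by (auto simp: abscissas_def)
  then show ?thesis by (simp add: artin_schreier_fibre[OF CHAR_K] card_image card_Fq)
qed

lemma card_points: "card points = card abscissas * q"
proof -
  have "card points = (\<Sum>x\<in>abscissas. card {y. artin_schreier m y = rhs x})"
    unfolding points_def by (rule card_SigmaI) simp_all
  then show ?thesis by (simp add: card_fibre)
qed

lemma suzuki_evaluation_code_plane_code:
  assumes "inj_on pt {..<l}" "pt ` {..<l} \<subseteq> points" "bipoly.subspace L"
  shows "suzuki_evaluation_code q0 q l (plane_code l pt L)"
proof -
  have "artin_schreier m 0 = poly rhs_poly 0" by (simp add: poly_rhs_poly rhs_def)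
  then interpret prime_plane_curve f by (rule prime_plane_curve)
  have "\<exists>V. place_at f (pt k) V" if "k < l" for k
  proof -
    have "pt k \<in> points" using assms(2) that by auto
    then show ?thesis
      using ex_place[of "snd (pt k)" "fst (pt k)"] by (auto simp: points_def poly_rhs_poly)
  qed
  then show ?thesis
    unfolding suzuki_evaluation_code_def suzuki_poly_eq
    by (intro is_evaluation_code_plane_code assms)
qed

end

text \<open>
  The parameter \<open>N\<close> counts the orbits of the torus \<open>z \<mapsto> (z x, z ^ (q0 + 1) y)\<close> on the abscissas. A monomial
  is invariant under the torus exactly if its exponent is excluded from \<open>exponents\<close>.
\<close>

locale suzuki_code = suzuki ty n a m q0 q
  for ty :: "'k::{finite,field} itself" and n a m q0 q +
  fixes N :: nat
  assumes card_abscissas_eq: "card abscissas = (q - 1) * N"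
begin

definition exponents :: "(nat \<times> nat) set" where
  "exponents = {(i, j). i < (q - 1) * N \<and> j < q - 1 \<and> \<not> (q - 1) dvd i + (q0 + 1) * j}"

abbreviation code_polys :: "'k poly poly set" where
  "code_polys \<equiv> monomial_space exponents"

lemma exponents_subset: "exponents \<subseteq> {..<(q - 1) * N} \<times> {..<q - 1}"
  by (auto simp: exponents_def)

lemma finite_exponents: "finite exponents"
  by (rule finite_subset[OF exponents_subset]) simp

lemma card_exponents: "card exponents = (q - 1) * (q - 2) * N"
  using card_exponents_not_dvd[of "q - 1" N "q - 1" "q0 + 1"] q_pos(3)
  by (simp add: exponents_def mult.assoc numeral_2_eq_2)

lemma coeff_code_polys_eq_0: "G \<in> code_polys \<Longrightarrow> j \<ge> q - 1 \<Longrightarrow> coeff G j = 0"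
  by (intro poly_eqI) (force simp: monomial_space_def exponents_def)

lemma code_polys_eq_0_if_vanishing:
  assumes "G \<in> code_polys" "\<And>p. p \<in> points \<Longrightarrow> poly2 G p = 0"
  shows "G = 0"
proof (rule eq_0_if_vanishing_on_fibres)
  show "G \<in> monomial_space ({..<(q - 1) * N} \<times> {..<q - 1})"
    using assms(1) exponents_subset by (auto simp: monomial_space_def)
  show "q - 1 \<le> card {y. artin_schreier m y = rhs x}" if "x \<in> abscissas" for x
    by (simp add: card_fibre[OF that])
qed (use assms(2) card_abscissas_eq in \<open>auto simp: points_def\<close>)

lemma fibre_determines:
  assumes "(x, y) \<in> points"
  shows "determines code_polys ({x} \<times> ({y. artin_schreier m y = rhs x} - {y})) (x, y)"
  unfolding determines_def
proof (intro ballI impI)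
  let ?Y = "{y. artin_schreier m y = rhs x} - {y}"
  fix G assume "G \<in> code_polys" and zero: "\<forall>b\<in>{x} \<times> ?Y. poly2 G b = 0"
  show "poly2 G (x, y) = 0"
  proof (rule poly2_eq_0_if_vanishing_on_fibre)
    show "coeff G j = 0" if "j \<ge> q - 1" for j
      using \<open>G \<in> code_polys\<close> that by (rule coeff_code_polys_eq_0)
    show "q - 1 \<le> card ?Y"
      using assms card_fibre[of x] by (simp add: points_def card_Diff_singleton)
    show "poly2 G (x, y') = 0" if "y' \<in> ?Y" for y' using zero that by simp
  qed
qed

lemma sum_torus_eq_0:
  assumes "G \<in> code_polys"
  shows "(\<Sum>z\<in>frob_fixed m - {0}. poly2 G (torus z p)) = 0"
proof -
  define V where "V = {G. (\<Sum>z\<in>frob_fixed m - {0}. poly2 G (torus z p)) = 0}"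
  have "bipoly.subspace V"
    by (rule bipoly.subspaceI)
      (simp_all add: V_def poly2_add poly2_smult sum.distrib sum_distrib_left[symmetric], simp add: poly2_def)
  moreover have "monomial e \<in> V" if "e \<in> exponents" for e
  proof -
    obtain i j where e_eq: "e = (i, j)" by force
    have "poly2 (monomial e) (torus z p) = poly2 (monomial e) p * z ^ (i + (q0 + 1) * j)" for z
      by (simp only: e_eq poly2_monomial torus_def fst_conv snd_conv power_mult_distrib power_add[of z i]
          power_mult) (simp only: mult_ac)
    moreover have "(\<Sum>z\<in>frob_fixed m - {0::'k}. z ^ (i + (q0 + 1) * j)) = 0"
      using that
      by (intro sum_power_eq_0) (auto simp: card_Fq_units frob_fixed_mult exponents_def e_eq)
    ultimately show ?thesis by (simp add: V_def sum_distrib_left[symmetric])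
  qed
  ultimately have "bipoly.span (monomial ` exponents) \<subseteq> V" by (intro bipoly.span_minimal) auto
  then show ?thesis using assms by (auto simp: V_def span_monomials[OF finite_exponents])
qed

lemma torus_orbit_determines: "determines code_polys ((\<lambda>z. torus z p) ` (frob_fixed m - {0, 1})) p"
  unfolding determines_def
proof (intro ballI impI)
  fix G assume "G \<in> code_polys" and zero: "\<forall>b\<in>(\<lambda>z. torus z p) ` (frob_fixed m - {0, 1}). poly2 G b = 0"
  have "(\<Sum>z\<in>frob_fixed m - {0}. poly2 G (torus z p))
      = poly2 G (torus 1 p) + (\<Sum>z\<in>frob_fixed m - {0} - {1}. poly2 G (torus z p))"
    by (rule sum.remove) (simp_all add: frob_fixed_1)
  also have "(\<Sum>z\<in>frob_fixed m - {0} - {1}. poly2 G (torus z p)) = 0"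
    using zero by (intro sum.neutral) auto
  finally show "poly2 G p = 0" using sum_torus_eq_0[OF \<open>G \<in> code_polys\<close>] by (simp add: torus_def)
qed

lemma ex_recovery_sets:
  assumes "p \<in> points"
  shows "\<exists>B1 B2. B1 \<subseteq> points - {p} \<and> B2 \<subseteq> points - {p} \<and> B1 \<inter> B2 = {} \<and>
    card B1 = q - 1 \<and> card B2 = q - 2 \<and> determines code_polys B1 p \<and> determines code_polys B2 p"
proof -
  obtain x y where p_eq: "p = (x, y)" by force
  have xy_point: "x \<in> abscissas" "artin_schreier m y = rhs x"
    using assms by (auto simp: p_eq points_def)
  let ?fibre = "{x} \<times> ({y. artin_schreier m y = rhs x} - {y})"
  let ?orbit = "(\<lambda>z. torus z p) ` (frob_fixed m - {0, 1})"
  have "?fibre \<subseteq> points - {p}" using xy_point by (auto simp: p_eq points_def)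
  moreover have "torus z p \<noteq> p" if "z \<noteq> 1" for z
    using that torus_inj[OF assms, of z 1] by (simp add: torus_def)
  then have "?orbit \<subseteq> points - {p}" by (simp add: image_subset_iff torus_in_points[OF assms])
  moreover have "?fibre \<inter> ?orbit = {}"
  proof (rule equals0I)
    fix b assume b_common: "b \<in> ?fibre \<inter> ?orbit"
    then obtain z where "z \<noteq> 1" "b = torus z p" by auto
    then have "fst b \<noteq> x" using xy_point(1) by (simp add: torus_def p_eq abscissas_def)
    moreover have "fst b = x" using b_common by (elim IntE SigmaE) simp
    ultimately show False by simp
  qed
  moreover have "card ?fibre = q - 1"
    using card_fibre[OF xy_point(1)] xy_point(2)
    by (simp add: card_cartesian_product card_Diff_singleton)
  moreover have "card ?orbit = q - 2"
  proof -
    have "card ?orbit = card (frob_fixed m - {0, 1::'k})"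
      by (intro card_image) (simp add: inj_on_def torus_inj[OF assms])
    also have "\<dots> = q - card {0, 1::'k}"
      by (subst card_Diff_subset) (simp_all add: frob_fixed_0 frob_fixed_1 card_Fq)
    finally show ?thesis by simp
  qed
  ultimately show ?thesis
    using fibre_determines[of x y] torus_orbit_determines[of p] assms unfolding p_eq by blast
qed

lemma ex_suzuki_code:
  "\<exists>C :: (nat \<Rightarrow> 'k) set. suzuki_evaluation_code q0 q (q * (q - 1) * N) C \<and>
    linear_code (q * (q - 1) * N) C \<and> word.dim C = (q - 1) * (q - 2) * N \<and>
    availability2_locality (q * (q - 1) * N) C (q - 1) (q - 2)"
proof -
  let ?l = "q * (q - 1) * N"
  have "card points = ?l" by (simp add: card_points card_abscissas_eq mult_ac)
  then obtain pt where pt_bij: "bij_betw pt {..<?l} points"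
    using ex_bij_betw_nat_finite[of points] by (auto simp: atLeast0LessThan)
  then have "inj_on pt {..<?l}" "pt ` {..<?l} = points" by (auto simp: bij_betw_def)
  note code_polys_subspace = subspace_monomial_space[of exponents]
  have "suzuki_evaluation_code q0 q ?l (plane_code ?l pt code_polys)"
    using \<open>inj_on pt {..<?l}\<close> \<open>pt ` {..<?l} = points\<close> code_polys_subspace
    by (intro suzuki_evaluation_code_plane_code) auto
  moreover have "word.dim (plane_code ?l pt code_polys) = (q - 1) * (q - 2) * N"
    unfolding card_exponents[symmetric]
  proof (rule dim_plane_code_monomial_space[OF finite_exponents])
    fix G assume "G \<in> code_polys" and zero: "\<And>k. k < ?l \<Longrightarrow> poly2 G (pt k) = 0"
    have "poly2 G p = 0" if "p \<in> points" for p
      using that zero unfolding \<open>pt ` {..<?l} = points\<close>[symmetric] by blast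
    then show "G = 0" using \<open>G \<in> code_polys\<close> by (intro code_polys_eq_0_if_vanishing)
  qed
  ultimately show ?thesis
    using linear_code_plane_code[OF code_polys_subspace]
      availability2_locality_plane_code[OF pt_bij code_polys_subspace ex_recovery_sets]
    by blast
qed

end

lemma suzuki_code_Fq:
  assumes "q0 = 2 ^ a" "q = 2 * q0\<^sup>2" and card: "CARD('k::{finite,field}) = q"
  shows "\<exists>C :: (nat \<Rightarrow> 'k) set. suzuki_evaluation_code q0 q (q * (q - 1)) C \<and>
    linear_code (q * (q - 1)) C \<and> word.dim C = (q - 1) * (q - 2) \<and>
    availability2_locality (q * (q - 1)) C (q - 1) (q - 2)"
proof -
  define m where "m = 2 * a + 1"
  have q_power: "q = 2 ^ m"
    using assms(1,2) by (simp add: m_def power_mult power2_eq_square mult_2 power_add)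
  interpret suzuki "TYPE('k)" m a m q0 q
    by unfold_locales (use card q_power m_def assms(1) in auto)
  have "rhs x = 0" for x
    using frob_fixed_UNIV artin_schreier_eq_0_iff[OF CHAR_K, of m x] by (simp add: rhs_def)
  moreover have "(0::'k) \<in> range (artin_schreier m)" by (rule range_eqI[of _ _ 0]) simp
  ultimately have "abscissas = UNIV - {0}" by (auto simp: abscissas_def)
  then interpret suzuki_code "TYPE('k)" m a m q0 q 1
    by unfold_locales (simp add: card card_Diff_singleton)
  show ?thesis using ex_suzuki_code by simp
qed

lemma suzuki_code_Fq4:
  assumes "q0 = 2 ^ a" "q = 2 * q0\<^sup>2" and card: "CARD('k::{finite,field}) = q ^ 4"
  defines "N \<equiv> q\<^sup>2 + 2 * q * q0 + q + 1"
  shows "\<exists>C :: (nat \<Rightarrow> 'k) set. suzuki_evaluation_code q0 q (q * (q - 1) * N) C \<and>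
    linear_code (q * (q - 1) * N) C \<and> word.dim C = (q - 1) * (q - 2) * N \<and>
    availability2_locality (q * (q - 1) * N) C (q - 1) (q - 2)"
proof -
  define m where "m = 2 * a + 1"
  have q_power: "q = 2 ^ m"
    using assms(1,2) by (simp add: m_def power_mult power2_eq_square mult_2 power_add)
  have "CARD('k) = 2 ^ (4 * m)" using card q_power by (simp add: mult.commute flip: power_mult)
  then interpret suzuki4 "TYPE('k)" "4 * m" a m q0 q
    by unfold_locales (use q_power m_def assms(1) in \<open>simp_all only: dvd_triv_right\<close>)
  interpret suzuki_code "TYPE('k)" "4 * m" a m q0 q N
    by unfold_locales (simp add: card_abscissas N_def)
  show ?thesis by (rule ex_suzuki_code)
qed

theorem theorem6p1:
  fixes a q0 q :: nat
  assumes "q0 = 2 ^ a" and "q = 2 * q0\<^sup>2"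
  shows
    "(CARD('k::{finite,field}) = q \<longrightarrow>
       (\<exists>C :: (nat \<Rightarrow> 'k) set.
          suzuki_evaluation_code q0 q (q * (q - 1)) C \<and>
          linear_code (q * (q - 1)) C \<and>
          word.dim C = (q - 1) * (q - 2) \<and>
          availability2_locality (q * (q - 1)) C (q - 1) (q - 2))) \<and>
     (CARD('l::{finite,field}) = q ^ 4 \<longrightarrow>
       (\<exists>C :: (nat \<Rightarrow> 'l) set.
          suzuki_evaluation_code q0 q (q * (q - 1) * (q\<^sup>2 + 2 * q * q0 + q + 1)) C \<and>
          linear_code (q * (q - 1) * (q\<^sup>2 + 2 * q * q0 + q + 1)) C \<and>
          word.dim C = (q - 1) * (q - 2) * (q\<^sup>2 + 2 * q * q0 + q + 1) \<and>
          availability2_locality (q * (q - 1) * (q\<^sup>2 + 2 * q * q0 + q + 1)) C (q - 1) (q - 2)))"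
  using suzuki_code_Fq[OF assms, where ?'k = 'k] suzuki_code_Fq4[OF assms, where ?'k = 'l] by blast

end
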